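(* Let $G=(V,E)$ be a simple undirected graph with $n$ vertices, $m$ edges, arboricity $\alpha$, and $T$ triangles, accessible only through the queries $\texttt{Degree}$, $\texttt{Neighbour}$, $\texttt{Edge}$ and $\texttt{RandomEdge}$ described below. For every $\varepsilon\in(0,1)$ and $\delta\in(0,1)$ there exists an algorithm which, given $n$, $m$, $\alpha$, $\varepsilon$, $\delta$ and query access to $G$, makes $\widetilde{O}\!\left(\frac{m\alpha\log\frac{1}{\delta}}{\varepsilon^{3}T}\right)$ queries in expectation and returns a value $X$ with $X\in\left[(1-\varepsilon)T,(1+\varepsilon)T\right]$ with probability at least $1-\delta$.
   Context: The arboricity of a graph is the minimum number of forests into which its edge set can be partitioned. Query model: $\texttt{Degree}(v)$ returns the degree $d(v)$ of vertex $v$; $\texttt{Neighbour}(v,i)$ returns the $i$-th neighbour of $v$ (in an arbitrary fixed order); $\texttt{Edge}(u,v)$ returns $1$ if $\{u,v\}\in E$ and $0$ otherwise; $\texttt{RandomEdge}$ returns an edge of $E$ chosen uniformly at random, independently of previous queries. The notation $\widetilde{O}(\cdot)$ hides factors polylogarithmic in $n$ (and polynomial dependence on $\varepsilon\log n$ of lower order as absorbed there). *)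

theory Defs
  imports "HOL-Probability.Probability"
begin

section \<open>Graphs\<close>

text \<open>Vertices carry natural-number labels, but the vertex set is an arbitrary finite set of labels,
  which is not revealed to algorithms. An edge is the two-element set of its endpoints.\<close>

definition simple_graph :: "nat set \<Rightarrow> nat set set \<Rightarrow> bool" where
  "simple_graph V E \<longleftrightarrow> finite V \<and> (\<forall>e\<in>E. e \<subseteq> V \<and> card e = 2)"

definition neighbours :: "nat set set \<Rightarrow> nat \<Rightarrow> nat set" where
  "neighbours E v = {u. {u, v} \<in> E}"

definition degree :: "nat set set \<Rightarrow> nat \<Rightarrow> nat" where
  "degree E v = card (neighbours E v)"

definition triangles :: "nat set \<Rightarrow> nat set set \<Rightarrow> nat set set" where
  "triangles V E = {S. S \<subseteq> V \<and> card S = 3 \<and> (\<forall>u\<in>S. \<forall>v\<in>S. u \<noteq> v \<longrightarrow> {u, v} \<in> E)}"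

definition cycle :: "nat set set \<Rightarrow> nat list \<Rightarrow> bool" where
  "cycle E vs \<longleftrightarrow> 3 \<le> length vs \<and> distinct vs \<and>
     (\<forall>i<length vs. {vs ! i, vs ! ((i + 1) mod length vs)} \<in> E)"

definition forest :: "nat set set \<Rightarrow> bool" where
  "forest E \<longleftrightarrow> (\<nexists>vs. cycle E vs)"

definition arboricity :: "nat set set \<Rightarrow> nat" where
  "arboricity E = (LEAST k. \<exists>F. (\<Union>i<k. F i) = E \<and> disjoint_family_on F {..<k} \<and>
     (\<forall>i<k. forest (F i)))"

text \<open>An ordering of the neighbours of every vertex; positions are counted from 0.\<close>

definition neighbour_order :: "nat set \<Rightarrow> nat set set \<Rightarrow> (nat \<Rightarrow> nat \<Rightarrow> nat) \<Rightarrow> bool" where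
  "neighbour_order V E nb \<longleftrightarrow> (\<forall>v\<in>V. bij_betw (nb v) {..<degree E v} (neighbours E v))"


section \<open>Randomised query algorithms\<close>

text \<open>A randomised algorithm is an adaptive decision tree. Each node either outputs a number,
  draws private randomness from a discrete distribution (which is not counted as a query),
  or asks a query and continues depending on the answer. As usual for query complexity, only
  queries are counted, and no computability is imposed. The trees are well-founded, that is, every
  run halts, but there need not be a common bound on the lengths of the runs.\<close>

datatype algorithm =
    Output real
  | Toss "nat pmf" "nat \<Rightarrow> algorithm"
  | Degree nat "nat \<Rightarrow> algorithm"
  | Neighbour nat nat "nat option \<Rightarrow> algorithm"
  | Edge nat nat "bool \<Rightarrow> algorithm"
  | RandomEdge "nat set \<Rightarrow> algorithm"

text \<open>The two degenerate queries get a harmless answer: a neighbour beyond the degree of the vertex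
  is \<^const>\<open>None\<close>, and a random edge of a graph without edges is the empty set. A label that is not a
  vertex looks like an isolated vertex.\<close>

definition neighbour_answer ::
  "nat set set \<Rightarrow> (nat \<Rightarrow> nat \<Rightarrow> nat) \<Rightarrow> nat \<Rightarrow> nat \<Rightarrow> nat option" where
  "neighbour_answer E nb v i = (if i < degree E v then Some (nb v i) else None)"

definition random_edge :: "nat set set \<Rightarrow> nat set pmf" where
  "random_edge E = (if E = {} then return_pmf {} else pmf_of_set E)"

definition count_query :: "(real \<times> nat) pmf \<Rightarrow> (real \<times> nat) pmf" where
  "count_query = map_pmf (\<lambda>(x, q). (x, Suc q))"

text \<open>The joint distribution of the output and the number of queries.\<close>

primrec run :: "nat set set \<Rightarrow> (nat \<Rightarrow> nat \<Rightarrow> nat) \<Rightarrow> algorithm \<Rightarrow> (real \<times> nat) pmf" where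
  "run E nb (Output x) = return_pmf (x, 0)"
| "run E nb (Toss p f) = bind_pmf p (\<lambda>r. run E nb (f r))"
| "run E nb (Degree v f) = count_query (run E nb (f (degree E v)))"
| "run E nb (Neighbour v i f) = count_query (run E nb (f (neighbour_answer E nb v i)))"
| "run E nb (Edge u v f) = count_query (run E nb (f ({u, v} \<in> E)))"
| "run E nb (RandomEdge f) = count_query (bind_pmf (random_edge E) (\<lambda>e. run E nb (f e)))"

definition expected_queries :: "(real \<times> nat) pmf \<Rightarrow> ennreal" where
  "expected_queries R = (\<integral>\<^sup>+ (x, q). of_nat q \<partial>measure_pmf R)"

definition output_prob :: "(real \<times> nat) pmf \<Rightarrow> real set \<Rightarrow> real" where
  "output_prob R S = measure_pmf.prob (map_pmf fst R) S"

end

theory Submission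
  imports Defs
begin

text \<open>A random edge is probed at random neighbours of its endpoint of lower degree; a graph of arboricity
  \<open>\<alpha>\<close> satisfies \<open>\<Sum>\<^bsub>uv\<in>E\<^esub> min (d u) (d v) \<le> 2 m \<alpha>\<close>, so \<open>min (d u) (d v) / \<alpha>\<close> probes per edge are
  affordable and make the variance caused by the probes small. The other source of variance are
  heavy edges, those in more than about \<open>\<tau> = O(\<alpha> / \<epsilon>)\<close> triangles. A randomised test rejects them,
  and each triangle is credited to the first of its edges that tests light; as each use of the test
  draws fresh randomness, a triangle with light probabilities \<open>p\<^sub>1, p\<^sub>2, p\<^sub>3\<close> is counted with
  expectation \<open>1 - (1 - p\<^sub>1) (1 - p\<^sub>2) (1 - p\<^sub>3)\<close>. The loss is at most \<open>O(\<alpha> / \<tau>)\<close> times the number of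
  triangles, because an orientation with outdegrees at most \<open>\<alpha>\<close> leaves at most \<open>\<alpha>\<close> triangles per
  edge. By Chebyshev \<open>O(m \<tau> / (\<epsilon>\<^sup>2 g))\<close> rounds give a good estimate of any count \<open>\<ge> g\<close>; halving the
  guess \<open>g\<close> until the estimate reaches it costs a constant factor, since both the failure
  probabilities and the costs form geometric series. The median of \<open>O(log (1 / \<delta>))\<close> runs concludes.\<close>

section \<open>Expectations of query algorithms\<close>

text \<open>The delicate cost is that of the tests inside a credit check, each of which may take
  about \<open>d / \<tau>\<close> probes, \<open>d\<close> being the smaller degree. A test stops at
  its first hit, so for an edge in \<open>t\<close> triangles, \<open>t\<close> times the expected
  cost of its test is \<open>O(t + d)\<close>. Checks run only on triangles that were found, so it
  is this product that gets summed over the edges; the total is \<open>O(m * \<alpha>)\<close>, the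
  same as for the probes, and a round costs a constant in expectation. The probability
  \<open>p\<close> of testing light only has to satisfy
  \<open>1 - t / \<tau> \<le> p \<le> exp (- t / \<tau>)\<close>: the lower bound controls the bias,
  the upper one gives \<open>p * t \<le> \<tau>\<close> and controls the second moment. Of the three
  factors \<open>1 / \<epsilon>\<close>, one comes from \<open>\<tau>\<close> and two from
  Chebyshev.\<close>

primrec bind_alg :: "algorithm \<Rightarrow> (real \<Rightarrow> algorithm) \<Rightarrow> algorithm" where
  "bind_alg (Output x) g = g x"
| "bind_alg (Toss p f) g = Toss p (\<lambda>r. bind_alg (f r) g)"
| "bind_alg (Degree v f) g = Degree v (\<lambda>r. bind_alg (f r) g)"
| "bind_alg (Neighbour v i f) g = Neighbour v i (\<lambda>r. bind_alg (f r) g)"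
| "bind_alg (Edge u v f) g = Edge u v (\<lambda>r. bind_alg (f r) g)"
| "bind_alg (RandomEdge f) g = RandomEdge (\<lambda>r. bind_alg (f r) g)"

primrec finite_tosses :: "algorithm \<Rightarrow> bool" where
  "finite_tosses (Output x) \<longleftrightarrow> True"
| "finite_tosses (Toss p f) \<longleftrightarrow> finite (set_pmf p) \<and> (\<forall>r. finite_tosses (f r))"
| "finite_tosses (Degree v f) \<longleftrightarrow> (\<forall>r. finite_tosses (f r))"
| "finite_tosses (Neighbour v i f) \<longleftrightarrow> (\<forall>r. finite_tosses (f r))"
| "finite_tosses (Edge u v f) \<longleftrightarrow> (\<forall>r. finite_tosses (f r))"
| "finite_tosses (RandomEdge f) \<longleftrightarrow> (\<forall>r. finite_tosses (f r))"

lemma finite_tosses_bind: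
  "finite_tosses A \<Longrightarrow> (\<And>x. finite_tosses (g x)) \<Longrightarrow> finite_tosses (bind_alg A g)"
  by (induction A) auto

text \<open>The expectation of \<open>F x + c * q\<close>, where \<open>x\<close> is the output and \<open>q\<close> the number of queries. Sums
  instead of integrals make it linear without side conditions; it is the true expectation if all
  tosses have finite support and the graph has an edge.\<close>

primrec expect ::
  "nat set set \<Rightarrow> (nat \<Rightarrow> nat \<Rightarrow> nat) \<Rightarrow> algorithm \<Rightarrow> (real \<Rightarrow> real) \<Rightarrow> real \<Rightarrow> real" where
  "expect E nb (Output x) F c = F x"
| "expect E nb (Toss p f) F c = (\<Sum>r\<in>set_pmf p. pmf p r * expect E nb (f r) F c)"
| "expect E nb (Degree v f) F c = c + expect E nb (f (degree E v)) F c"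
| "expect E nb (Neighbour v i f) F c = c + expect E nb (f (neighbour_answer E nb v i)) F c"
| "expect E nb (Edge u v f) F c = c + expect E nb (f ({u, v} \<in> E)) F c"
| "expect E nb (RandomEdge f) F c = c + (\<Sum>e\<in>E. expect E nb (f e) F c) / real (card E)"

lemma expect_bind:
  "expect E nb (bind_alg A g) F c = expect E nb A (\<lambda>x. expect E nb (g x) F c) c"
  by (induction A) auto

lemma expect_add:
  "expect E nb A (\<lambda>x. F x + G x) (c + d) = expect E nb A F c + expect E nb A G d"
  by (induction A) (simp_all add: sum.distrib algebra_simps add_divide_distrib)

lemma expect_mult:
  "expect E nb A (\<lambda>x. a * F x) (a * c) = a * expect E nb A F c"
  by (induction A) (simp_all add: sum_distrib_left algebra_simps)

lemma expect_add0: "expect E nb A (\<lambda>x. F x + G x) 0 = expect E nb A F 0 + expect E nb A G 0"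
  using expect_add[of E nb A F G 0 0] by simp

lemma expect_mult0: "expect E nb A (\<lambda>x. a * F x) 0 = a * expect E nb A F 0"
  using expect_mult[of E nb A a F 0] by simp

lemma expect_split: "expect E nb A F c = expect E nb A F 0 + expect E nb A (\<lambda>_. 0) c"
  using expect_add[of E nb A F "\<lambda>_. 0" 0 c] by simp

lemma expect_mono:
  assumes "\<And>x. F x \<le> G x"
  shows "expect E nb A F c \<le> expect E nb A G c"
  by (induction A) (auto intro!: sum_mono mult_left_mono divide_right_mono simp: assms)

lemma expect_nonneg:
  assumes "\<And>x. 0 \<le> F x" "0 \<le> c"
  shows "0 \<le> expect E nb A F c"
  by (induction A) (auto intro!: add_nonneg_nonneg sum_nonneg mult_nonneg_nonneg divide_nonneg_nonneg simp: assms)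

lemma expect_const:
  assumes "finite_tosses A" "finite E" "E \<noteq> {}"
  shows "expect E nb A (\<lambda>_. a) 0 = a"
  using assms
proof (induction A)
  case (Toss p f)
  then have "expect E nb (Toss p f) (\<lambda>_. a) 0 = (\<Sum>r\<in>set_pmf p. pmf p r) * a"
    by (simp add: sum_distrib_right)
  then show ?case using Toss by (simp add: sum_pmf_eq_1)
qed simp_all

lemma nn_integral_count_query:
  assumes "\<And>x. 0 \<le> F x" "0 \<le> c"
  shows "(\<integral>\<^sup>+ (x, q). ennreal (F x + c * real q) \<partial>measure_pmf (count_query R)) =
    ennreal c + (\<integral>\<^sup>+ (x, q). ennreal (F x + c * real q) \<partial>measure_pmf R)"
proof -
  have "(\<integral>\<^sup>+ (x, q). ennreal (F x + c * real q) \<partial>measure_pmf (count_query R)) =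
      (\<integral>\<^sup>+ z. ennreal c + (case z of (x, q) \<Rightarrow> ennreal (F x + c * real q)) \<partial>measure_pmf R)"
    unfolding count_query_def nn_integral_map_pmf
    using assms by (intro nn_integral_cong)
      (auto simp: algebra_simps simp flip: ennreal_plus split: prod.splits)
  also have "\<dots> = ennreal c + (\<integral>\<^sup>+ (x, q). ennreal (F x + c * real q) \<partial>measure_pmf R)"
    by (subst nn_integral_add) auto
  finally show ?thesis .
qed

text \<open>The bridge from the semantics \<open>run\<close> to the algebraic \<open>expect\<close>.
  \<open>F\<close> and \<open>c\<close> are nonnegative so that the integrals live in
  \<open>ennreal\<close> and need no integrability.\<close>

lemma nn_integral_run:
  assumes "finite_tosses A" "finite E" "E \<noteq> {}" "\<And>x. 0 \<le> F x" "0 \<le> c"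
  shows "(\<integral>\<^sup>+ (x, q). ennreal (F x + c * real q) \<partial>measure_pmf (run E nb A)) =
    ennreal (expect E nb A F c)"
  using assms(1)
proof (induction A)
  case (Toss p f)
  have nn: "0 \<le> expect E nb (f r) F c" for r
    using assms by (intro expect_nonneg) auto
  have fin: "finite (set_pmf p)" using Toss.prems by simp
  have "(\<integral>\<^sup>+ (x, q). ennreal (F x + c * real q) \<partial>measure_pmf (run E nb (Toss p f))) =
      (\<integral>\<^sup>+ r. ennreal (expect E nb (f r) F c) \<partial>measure_pmf p)"
    using Toss by simp
  also have "\<dots> = (\<Sum>r\<in>set_pmf p. ennreal (expect E nb (f r) F c) * ennreal (pmf p r))"
    using fin by (simp add: nn_integral_measure_pmf_finite)
  also have "\<dots> = ennreal (expect E nb (Toss p f) F c)"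
    using nn by (simp add: mult.commute flip: ennreal_mult)
  finally show ?case .
next
  case (RandomEdge f)
  have nn: "0 \<le> expect E nb (f r) F c" for r
    using assms by (intro expect_nonneg) auto
  have "(\<integral>\<^sup>+ (x, q). ennreal (F x + c * real q) \<partial>measure_pmf (run E nb (RandomEdge f))) =
      ennreal c + (\<integral>\<^sup>+ e. ennreal (expect E nb (f e) F c) \<partial>measure_pmf (pmf_of_set E))"
    using RandomEdge assms
    by (simp add: nn_integral_count_query random_edge_def del: ennreal_plus)
  also have "(\<integral>\<^sup>+ e. ennreal (expect E nb (f e) F c) \<partial>measure_pmf (pmf_of_set E)) =
      ennreal ((\<Sum>e\<in>E. expect E nb (f e) F c) / real (card E))"
    using assms nn by (subst nn_integral_pmf_of_set)
      (auto simp: divide_ennreal sum_nonneg card_gt_0_iff ennreal_of_nat_eq_real_of_nat)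
  finally show ?case
    using assms nn by (simp add: ennreal_plus sum_nonneg)
qed (use assms in \<open>simp_all add: nn_integral_count_query expect_nonneg del: ennreal_plus
    flip: ennreal_plus\<close>)

lemma expected_queries_run:
  assumes "finite_tosses A" "finite E" "E \<noteq> {}"
  shows "expected_queries (run E nb A) = ennreal (expect E nb A (\<lambda>_. 0) 1)"
  using nn_integral_run[OF assms, of "\<lambda>_. 0" 1 nb]
  by (simp add: expected_queries_def ennreal_of_nat_eq_real_of_nat)

lemma output_prob_run:
  assumes "finite_tosses A" "finite E" "E \<noteq> {}"
  shows "output_prob (run E nb A) S = expect E nb A (indicat_real S) 0"
proof -
  have "ennreal (output_prob (run E nb A) S) =
      (\<integral>\<^sup>+ z. indicator S z \<partial>measure_pmf (map_pmf fst (run E nb A)))"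
    by (simp add: output_prob_def measure_pmf.emeasure_eq_measure[symmetric] del: emeasure_map_pmf measure_map_pmf nn_integral_map_pmf)
  also have "\<dots> = (\<integral>\<^sup>+ (x, q). ennreal (indicat_real S x + 0 * real q) \<partial>measure_pmf (run E nb A))"
    unfolding nn_integral_map_pmf
    by (intro nn_integral_cong) (auto simp: indicator_def)
  also have "\<dots> = ennreal (expect E nb A (indicat_real S) 0)"
    by (rule nn_integral_run[OF assms]) auto
  finally show ?thesis
    by (simp add: output_prob_def expect_nonneg)
qed

section \<open>Forests and orientations\<close>

definition edge_path :: "nat set set \<Rightarrow> nat list \<Rightarrow> bool" where
  "edge_path F vs \<longleftrightarrow> 2 \<le> length vs \<and> distinct vs \<and> (\<forall>i. Suc i < length vs \<longrightarrow> {vs ! i, vs ! Suc i} \<in> F)"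

text \<open>Paths are extended at the head, so a chord returns to position 0 and the cycle is a
  prefix. \<open>2 \<le> i\<close> gives it the required three vertices.\<close>

lemma edge_path_closes_cycle:
  assumes "edge_path F vs" "2 \<le> i" "i < length vs" "{vs ! i, vs ! 0} \<in> F"
  shows "cycle F (take (Suc i) vs)"
proof -
  have len: "length (take (Suc i) vs) = Suc i" using assms by simp
  have "{take (Suc i) vs ! j, take (Suc i) vs ! ((j + 1) mod Suc i)} \<in> F" if "j < Suc i" for j
  proof (cases "j = i")
    case False
    then have "(j + 1) mod Suc i = Suc j" "Suc j < Suc i" using that by auto
    then show ?thesis using assms that by (auto simp: edge_path_def)
  qed (use assms in auto)
  then show ?thesis
    using assms unfolding cycle_def len by (auto simp: edge_path_def)
qed

text \<open>Longest path argument: without leaves, the head of a longest path has a neighbour other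
  than its successor, which either lies on the path and closes a cycle or prolongs the path.\<close>

lemma forest_has_leaf:
  assumes "forest F" "finite F" "F \<noteq> {}" "\<And>e. e \<in> F \<Longrightarrow> card e = 2"
  shows "\<exists>u v. {u, v} \<in> F \<and> (\<forall>w. {w, v} \<in> F \<longrightarrow> w = u)"
proof (rule ccontr)
  assume no_leaf: "\<not> ?thesis"
  have fin: "finite (\<Union>F)"
    using assms(2,4) by (metis card.infinite finite_Union zero_neq_numeral)
  have len: "length vs \<le> card (\<Union>F)" if "edge_path F vs" for vs
  proof -
    have "set vs \<subseteq> \<Union>F"
    proof
      fix x assume "x \<in> set vs"
      then obtain i where i: "i < length vs" "x = vs ! i" by (auto simp: in_set_conv_nth)
      show "x \<in> \<Union>F"
      proof (cases "Suc i < length vs")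
        case True
        then show ?thesis using that i by (auto simp: edge_path_def)
      next
        case False
        then have "i = Suc (i - 1)" "Suc (i - 1) < length vs" using that i by (auto simp: edge_path_def)
        then have "{vs ! (i - 1), vs ! i} \<in> F" using that unfolding edge_path_def by metis
        then show ?thesis using i by auto
      qed
    qed
    then show ?thesis
      using that fin by (metis card_mono distinct_card edge_path_def)
  qed
  obtain e where "e \<in> F" using assms(3) by auto
  then obtain a b where ab: "{a, b} \<in> F" "a \<noteq> b"
    using assms(4) by (metis card_2_iff)
  have "edge_path F [a, b]" using ab by (auto simp: edge_path_def)
  then obtain vs where vs: "edge_path F vs" "\<And>ws. edge_path F ws \<Longrightarrow> length ws \<le> length vs"
    using ex_has_greatest_nat[of "edge_path F" "[a, b]" length "Suc (card (\<Union>F))"] len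
    by (auto simp: less_Suc_eq_le)
  have "{vs ! 1, vs ! 0} \<in> F"
    using vs(1) by (auto simp: edge_path_def insert_commute)
  then obtain w where w: "{w, vs ! 0} \<in> F" "w \<noteq> vs ! 1"
    using no_leaf by blast
  have "w \<noteq> vs ! 0" using assms(4)[OF w(1)] by auto
  show False
  proof (cases "w \<in> set vs")
    case True
    then obtain i where i: "i < length vs" "vs ! i = w" by (auto simp: in_set_conv_nth)
    moreover have "i \<noteq> 0" "i \<noteq> 1" using i w(2) \<open>w \<noteq> vs ! 0\<close> by metis+
    ultimately have "cycle F (take (Suc i) vs)"
      using vs(1) w by (intro edge_path_closes_cycle) auto
    then show False using assms(1) by (auto simp: forest_def)
  next
    case False
    have "edge_path F (w # vs)"
      using vs(1) False w by (auto simp: edge_path_def nth_Cons split: nat.splits)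
    then show False using vs(2) by fastforce
  qed
qed

lemma forest_subset: "forest F \<Longrightarrow> F' \<subseteq> F \<Longrightarrow> forest F'"
  unfolding forest_def cycle_def by (meson subsetD)

text \<open>\<open>P\<close> is a parent function, so every vertex has outdegree at most 1. Remove
  the edge at a leaf \<open>v\<close>, orient the rest, and let \<open>v\<close> point to its
  neighbour; no remaining edge contains \<open>v\<close>, so changing \<open>P v\<close> does no
  harm.\<close>

lemma forest_orientation:
  assumes "finite F" "forest F" "\<And>e. e \<in> F \<Longrightarrow> card e = 2"
  shows "\<exists>P. (\<forall>a b. {a, b} \<in> F \<longrightarrow> P a = b \<or> P b = a)"
  using assms
proof (induction F rule: finite_psubset_induct)
  case (psubset F)
  show ?case
  proof (cases "F = {}")
    case False
    have "\<exists>u v. {u, v} \<in> F \<and> (\<forall>w. {w, v} \<in> F \<longrightarrow> w = u)"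
      by (rule forest_has_leaf[OF psubset.prems(1) psubset.hyps False psubset.prems(2)])
    then obtain u v where uv: "{u, v} \<in> F" "\<forall>w. {w, v} \<in> F \<longrightarrow> w = u"
      by (elim exE conjE)
    have "F - {{u, v}} \<subset> F" using uv(1) by auto
    moreover have "forest (F - {{u, v}})" by (rule forest_subset[OF psubset.prems(1)]) simp
    ultimately have "\<exists>P. \<forall>a b. {a, b} \<in> F - {{u, v}} \<longrightarrow> P a = b \<or> P b = a"
      using psubset.prems(2) by (intro psubset.IH) simp_all
    then obtain P where P: "\<And>a b. {a, b} \<in> F - {{u, v}} \<Longrightarrow> P a = b \<or> P b = a"
      by blast
    have "(P(v := u)) a = b \<or> (P(v := u)) b = a" if ab: "{a, b} \<in> F" for a b
    proof (cases "{a, b} = {u, v}")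
      case False
      then have "a \<noteq> v" "b \<noteq> v"
        using uv(2)[rule_format, of b] uv(2)[rule_format, of a] ab by (auto simp: insert_commute)
      then show ?thesis using P[of a b] ab False by auto
    qed (auto simp: doubleton_eq_iff)
    then show ?thesis by blast
  qed simp
qed

text \<open>The \<open>LEAST\<close> in \<open>arboricity\<close> is meaningful only if some
  decomposition exists. The one into single edges serves: a cycle contains two different consecutive
  edges.\<close>

lemma arboricity_forests:
  assumes "finite E" "\<And>e. e \<in> E \<Longrightarrow> card e = 2"
  obtains F where "(\<Union>i<arboricity E. F i) = E" "\<And>i. i < arboricity E \<Longrightarrow> forest (F i)"
proof -
  obtain f :: "nat \<Rightarrow> nat set" where f: "bij_betw f {..<card E} E"
    using ex_bij_betw_nat_finite[OF assms(1)] by (auto simp: atLeast0LessThan)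
  have "forest {f i}" for i
    unfolding forest_def
  proof
    assume "\<exists>vs. cycle {f i} vs"
    then obtain vs where vs: "3 \<le> length vs" "distinct vs"
      and step: "\<And>j. j < length vs \<Longrightarrow> {vs ! j, vs ! ((j + 1) mod length vs)} = f i"
      by (auto simp: cycle_def)
    have l: "0 < length vs" "1 < length vs" "2 < length vs" using vs(1) by linarith+
    have "vs ! 0 \<noteq> vs ! 1" "vs ! 0 \<noteq> vs ! 2" "vs ! 1 \<noteq> vs ! 2"
      using nth_eq_iff_index_eq[OF vs(2) l(1) l(2)] nth_eq_iff_index_eq[OF vs(2) l(1) l(3)]
        nth_eq_iff_index_eq[OF vs(2) l(2) l(3)] by simp_all
    moreover have "{vs ! 0, vs ! 1} = {vs ! 1, vs ! 2}"
      using l step[of 0] step[of 1] by (simp add: mod_less numeral_2_eq_2)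
    ultimately show False by (auto simp: doubleton_eq_iff)
  qed
  moreover have "(\<Union>i<card E. {f i}) = E" using f by (auto simp: bij_betw_def)
  moreover have "disjoint_family_on (\<lambda>i. {f i}) {..<card E}"
    using f by (auto simp: disjoint_family_on_def bij_betw_def inj_on_def)
  ultimately have "\<exists>F. (\<Union>i<card E. F i) = E \<and> disjoint_family_on F {..<card E} \<and>
      (\<forall>i<card E. forest (F i))"
    by (intro exI[of _ "\<lambda>i. {f i}"]) auto
  then have "\<exists>F. (\<Union>i<arboricity E. F i) = E \<and> disjoint_family_on F {..<arboricity E} \<and>
      (\<forall>i<arboricity E. forest (F i))"
    unfolding arboricity_def by (rule LeastI)
  then show ?thesis using that by blast
qed

text \<open>The out-neighbours of a vertex are its parents in the forests, at most one per
  forest.\<close>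

lemma arboricity_orientation:
  assumes "finite E" "\<And>e. e \<in> E \<Longrightarrow> card e = 2"
  obtains out :: "nat \<Rightarrow> nat set"
    where "\<And>a. finite (out a)" "\<And>a. card (out a) \<le> arboricity E"
      and "\<And>a b. {a, b} \<in> E \<Longrightarrow> b \<in> out a \<or> a \<in> out b"
proof -
  obtain F where F: "(\<Union>i<arboricity E. F i) = E" "\<And>i. i < arboricity E \<Longrightarrow> forest (F i)"
    using arboricity_forests[OF assms] by metis
  have "\<exists>P. \<forall>a b. {a, b} \<in> F i \<longrightarrow> P a = b \<or> P b = a" if "i < arboricity E" for i
  proof (rule forest_orientation)
    show "finite (F i)" using F(1) assms(1) that by (metis UN_upper finite_subset lessThan_iff)
    show "forest (F i)" using F(2) that .
    show "card e = 2" if "e \<in> F i" for e using assms(2) F(1) that \<open>i < _\<close> by blast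
  qed
  then obtain P where P: "\<And>i a b. i < arboricity E \<Longrightarrow> {a, b} \<in> F i \<Longrightarrow> P i a = b \<or> P i b = a"
    by metis
  show ?thesis
  proof (rule that[of "\<lambda>a. (\<lambda>i. P i a) ` {..<arboricity E}"])
    show "card ((\<lambda>i. P i a) ` {..<arboricity E}) \<le> arboricity E" for a
      using card_image_le[of "{..<arboricity E}" "\<lambda>i. P i a"] by simp
    show "b \<in> (\<lambda>i. P i a) ` {..<arboricity E} \<or> a \<in> (\<lambda>i. P i b) ` {..<arboricity E}"
      if "{a, b} \<in> E" for a b
    proof -
      have "{a, b} \<in> (\<Union>i<arboricity E. F i)" using F(1) that by simp
      then obtain i where "i < arboricity E" "{a, b} \<in> F i" by auto
      then show ?thesis using P[of i a b] by auto
    qed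
  qed simp
qed

section \<open>Ordered triangles\<close>

definition arcs :: "nat set set \<Rightarrow> (nat \<times> nat) set" where
  "arcs E = {(a, b). {a, b} \<in> E}"

definition common :: "nat set set \<Rightarrow> nat \<Rightarrow> nat \<Rightarrow> nat set" where
  "common E a b = neighbours E a \<inter> neighbours E b"

text \<open>Every triangle occurs in all six orders, so sums can be rearranged by permuting
  coordinates; \<open>sorted_triads\<close> keeps one order per triangle.\<close>

definition triads :: "nat set set \<Rightarrow> (nat \<times> nat \<times> nat) set" where
  "triads E = {(a, b, c). {a, b} \<in> E \<and> {a, c} \<in> E \<and> {b, c} \<in> E}"

definition sorted_triads :: "nat set set \<Rightarrow> (nat \<times> nat \<times> nat) set" where
  "sorted_triads E = {(a, b, c). (a, b, c) \<in> triads E \<and> a < b \<and> b < c}"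

definition min_degree :: "nat set set \<Rightarrow> nat \<Rightarrow> nat \<Rightarrow> nat" where
  "min_degree E a b = min (degree E a) (degree E b)"

lemma common_commute: "common E a b = common E b a"
  by (auto simp: common_def)

lemma min_degree_commute: "min_degree E a b = min_degree E b a"
  by (simp add: min_degree_def)

locale edge_set =
  fixes E :: "nat set set"
  assumes finite_edges: "finite E" and card_edge: "e \<in> E \<Longrightarrow> card e = 2"
begin

lemma edge_neq: "{a, b} \<in> E \<Longrightarrow> a \<noteq> b"
  using card_edge[of "{a, b}"] by auto

lemma finite_vertices: "finite (\<Union>E)"
  using finite_edges card_edge by (metis card.infinite finite_Union zero_neq_numeral)

lemma finite_neighbours: "finite (neighbours E v)"
  by (rule finite_subset[OF _ finite_vertices]) (auto simp: neighbours_def)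

lemma finite_arcs: "finite (arcs E)"
  by (rule finite_subset[of _ "\<Union>E \<times> \<Union>E"]) (auto simp: arcs_def finite_vertices)

lemma finite_triads: "finite (triads E)"
  by (rule finite_subset[of _ "\<Union>E \<times> \<Union>E \<times> \<Union>E"]) (auto simp: triads_def finite_vertices)

lemma finite_common: "finite (common E a b)"
  by (simp add: common_def finite_neighbours)

lemma card_common_le: "card (common E a b) \<le> min_degree E a b"
  by (auto simp: common_def min_degree_def degree_def intro!: card_mono finite_neighbours)

lemma sum_arcs_swap: "(\<Sum>(a, b)\<in>arcs E. f a b) = (\<Sum>(a, b)\<in>arcs E. f b a)"
  by (rule sum.reindex_bij_witness[where i = prod.swap and j = prod.swap])
    (auto simp: arcs_def insert_commute)

text \<open>Random edges are sets whose endpoints are named by \<open>Min\<close> and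
  \<open>Max\<close>; the analysis runs over arcs, where each edge occurs in both
  directions.\<close>

lemma sum_edges:
  fixes f :: "nat \<Rightarrow> nat \<Rightarrow> real"
  assumes "\<And>a b. f a b = f b a"
  shows "2 * (\<Sum>e\<in>E. f (Min e) (Max e)) = (\<Sum>(a, b)\<in>arcs E. f a b)"
proof -
  let ?U = "{(a, b) \<in> arcs E. a < b}" and ?D = "{(a, b) \<in> arcs E. b < a}"
  have U: "(\<Sum>e\<in>E. f (Min e) (Max e)) = (\<Sum>(a, b)\<in>?U. f a b)"
  proof (rule sum.reindex_bij_witness[where i = "\<lambda>(a, b). {a, b}" and j = "\<lambda>e. (Min e, Max e)"])
    fix e assume e: "e \<in> E"
    then obtain a b where ab: "e = {a, b}" "a \<noteq> b" using card_edge by (meson card_2_iff)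
    then show "(case (Min e, Max e) of (a, b) \<Rightarrow> {a, b}) = e" "(Min e, Max e) \<in> ?U"
      using e by (auto simp: arcs_def min_def max_def insert_commute)
  qed (auto simp: arcs_def)
  have D: "(\<Sum>(a, b)\<in>?D. f a b) = (\<Sum>(a, b)\<in>?U. f a b)"
    by (rule sum.reindex_bij_witness[where i = prod.swap and j = prod.swap])
      (auto simp: arcs_def insert_commute assms)
  have "arcs E = ?U \<union> ?D"
    using edge_neq by (fastforce simp: arcs_def)
  then have "(\<Sum>(a, b)\<in>arcs E. f a b) = (\<Sum>(a, b)\<in>?U \<union> ?D. f a b)" by metis
  also have "\<dots> = (\<Sum>(a, b)\<in>?U. f a b) + (\<Sum>(a, b)\<in>?D. f a b)"
    by (rule sum.union_disjoint) (auto intro: finite_subset[OF _ finite_arcs])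
  finally show ?thesis using U D by simp
qed

lemma card_arcs: "real (card (arcs E)) = 2 * real (card E)"
  using sum_edges[of "\<lambda>_ _. 1"] by (simp add: case_prod_unfold)

lemma sum_arcs_common:
  "(\<Sum>(a, b)\<in>arcs E. \<Sum>c\<in>common E a b. f a b c) = (\<Sum>(a, b, c)\<in>triads E. f a b c)"
proof -
  have "(\<Sum>(a, b)\<in>arcs E. \<Sum>c\<in>common E a b. f a b c) =
      (\<Sum>p\<in>arcs E. \<Sum>c\<in>common E (fst p) (snd p). f (fst p) (snd p) c)"
    by (simp add: case_prod_unfold)
  also have "\<dots> = (\<Sum>(p, c)\<in>Sigma (arcs E) (\<lambda>p. common E (fst p) (snd p)). f (fst p) (snd p) c)"
    by (rule sum.Sigma) (auto simp: finite_arcs finite_common)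
  also have "\<dots> = (\<Sum>(a, b, c)\<in>triads E. f a b c)"
    by (rule sum.reindex_bij_witness[where i = "\<lambda>(a, b, c). ((a, b), c)"
          and j = "\<lambda>((a, b), c). (a, b, c)"])
      (auto simp: triads_def arcs_def common_def neighbours_def insert_commute)
  finally show ?thesis .
qed

lemma sum_triads_rotate:
  "(\<Sum>(a, b, c)\<in>triads E. f b c a) = (\<Sum>(a, b, c)\<in>triads E. f a b c)"
  by (rule sum.reindex_bij_witness[where i = "\<lambda>(a, b, c). (c, a, b)" and j = "\<lambda>(a, b, c). (b, c, a)"])
    (auto simp: triads_def insert_commute)

lemma sum_triads_swap:
  "(\<Sum>(a, b, c)\<in>triads E. f b a c) = (\<Sum>(a, b, c)\<in>triads E. f a b c)"
  by (rule sum.reindex_bij_witness[where i = "\<lambda>(a, b, c). (b, a, c)" and j = "\<lambda>(a, b, c). (b, a, c)"])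
    (auto simp: triads_def insert_commute)

text \<open>The vertices of a triad are distinct, so exactly one of six strict orders holds. Each of
  the six classes is carried to the sorted one by its own permutation of coordinates.\<close>

lemma sum_triads_sorted:
  fixes f :: "nat \<Rightarrow> nat \<Rightarrow> nat \<Rightarrow> real"
  shows "(\<Sum>(a, b, c)\<in>triads E. f a b c) =
    (\<Sum>(a, b, c)\<in>sorted_triads E. f a b c + f a c b + f b a c + f b c a + f c a b + f c b a)"
proof -
  let ?g = "\<lambda>P a b c. if P then f a b c else 0"
  let ?s = "\<lambda>h. \<Sum>(a, b, c)\<in>triads E. h a b c"
  have neq: "a \<noteq> b \<and> a \<noteq> c \<and> b \<noteq> c" if "(a, b, c) \<in> triads E" for a b c
    using that edge_neq by (auto simp: triads_def)
  have "?s f = ?s (\<lambda>a b c. ?g (a < b \<and> b < c) a b c + ?g (a < c \<and> c < b) a b c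
      + ?g (b < a \<and> a < c) a b c + ?g (c < a \<and> a < b) a b c
      + ?g (b < c \<and> c < a) a b c + ?g (c < b \<and> b < a) a b c)"
    by (rule sum.cong) (auto dest!: neq)
  also have "\<dots> = ?s (\<lambda>a b c. ?g (a < b \<and> b < c) a b c) + ?s (\<lambda>a b c. ?g (a < c \<and> c < b) a b c)
      + ?s (\<lambda>a b c. ?g (b < a \<and> a < c) a b c) + ?s (\<lambda>a b c. ?g (c < a \<and> a < b) a b c)
      + ?s (\<lambda>a b c. ?g (b < c \<and> c < a) a b c) + ?s (\<lambda>a b c. ?g (c < b \<and> b < a) a b c)"
    by (simp add: sum.distrib case_prod_unfold)
  also have "?s (\<lambda>a b c. ?g (a < c \<and> c < b) a b c) = ?s (\<lambda>a b c. ?g (a < b \<and> b < c) a c b)"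
    by (rule sum.reindex_bij_witness[where i = "\<lambda>(a, b, c). (a, c, b)" and j = "\<lambda>(a, b, c). (a, c, b)"])
      (auto simp: triads_def insert_commute)
  also have "?s (\<lambda>a b c. ?g (b < a \<and> a < c) a b c) = ?s (\<lambda>a b c. ?g (a < b \<and> b < c) b a c)"
    by (rule sum.reindex_bij_witness[where i = "\<lambda>(a, b, c). (b, a, c)" and j = "\<lambda>(a, b, c). (b, a, c)"])
      (auto simp: triads_def insert_commute)
  also have "?s (\<lambda>a b c. ?g (c < a \<and> a < b) a b c) = ?s (\<lambda>a b c. ?g (a < b \<and> b < c) b c a)"
    by (rule sum.reindex_bij_witness[where i = "\<lambda>(a, b, c). (b, c, a)" and j = "\<lambda>(a, b, c). (c, a, b)"])
      (auto simp: triads_def insert_commute)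
  also have "?s (\<lambda>a b c. ?g (b < c \<and> c < a) a b c) = ?s (\<lambda>a b c. ?g (a < b \<and> b < c) c a b)"
    by (rule sum.reindex_bij_witness[where i = "\<lambda>(a, b, c). (c, a, b)" and j = "\<lambda>(a, b, c). (b, c, a)"])
      (auto simp: triads_def insert_commute)
  also have "?s (\<lambda>a b c. ?g (c < b \<and> b < a) a b c) = ?s (\<lambda>a b c. ?g (a < b \<and> b < c) c b a)"
    by (rule sum.reindex_bij_witness[where i = "\<lambda>(a, b, c). (c, b, a)" and j = "\<lambda>(a, b, c). (c, b, a)"])
      (auto simp: triads_def insert_commute)
  also have "?s (\<lambda>a b c. ?g (a < b \<and> b < c) a b c) + ?s (\<lambda>a b c. ?g (a < b \<and> b < c) a c b)
      + ?s (\<lambda>a b c. ?g (a < b \<and> b < c) b a c) + ?s (\<lambda>a b c. ?g (a < b \<and> b < c) b c a)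
      + ?s (\<lambda>a b c. ?g (a < b \<and> b < c) c a b) + ?s (\<lambda>a b c. ?g (a < b \<and> b < c) c b a)
    = (\<Sum>p\<in>triads E. if (case p of (a, b, c) \<Rightarrow> a < b \<and> b < c)
        then (case p of (a, b, c) \<Rightarrow> f a b c + f a c b + f b a c + f b c a + f c a b + f c b a) else 0)"
    by (simp add: sum.distrib[symmetric] case_prod_unfold) (rule sum.cong, auto)
  also have "\<dots> = (\<Sum>p\<in>{p \<in> triads E. case p of (a, b, c) \<Rightarrow> a < b \<and> b < c}.
        case p of (a, b, c) \<Rightarrow> f a b c + f a c b + f b a c + f b c a + f c a b + f c b a)"
    by (rule sum.inter_filter[symmetric, OF finite_triads])
  also have "{p \<in> triads E. case p of (a, b, c) \<Rightarrow> a < b \<and> b < c} = sorted_triads E"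
    by (auto simp: sorted_triads_def)
  finally show ?thesis .
qed

lemma card_triads: "real (card (triads E)) = 6 * real (card (sorted_triads E))"
  using sum_triads_sorted[of "\<lambda>_ _ _. 1"] by (simp add: case_prod_unfold)

lemma card_sorted_triads:
  assumes "\<And>e. e \<in> E \<Longrightarrow> e \<subseteq> V"
  shows "card (sorted_triads E) = card (triangles V E)"
proof (rule bij_betw_same_card)
  show "bij_betw (\<lambda>(a, b, c). {a, b, c}) (sorted_triads E) (triangles V E)"
  proof (rule bij_betw_imageI)
    show "inj_on (\<lambda>(a, b, c). {a, b, c}) (sorted_triads E)"
    proof (rule inj_onI)
      fix p q
      assume pq: "p \<in> sorted_triads E" "q \<in> sorted_triads E"
        "(case p of (a, b, c) \<Rightarrow> {a, b, c}) = (case q of (a, b, c) \<Rightarrow> {a, b, c})"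
      obtain a b c where p: "p = (a, b, c)" by (cases p)
      obtain a' b' c' where q: "q = (a', b', c')" by (cases q)
      have eq: "{a, b, c} = {a', b', c'}" using pq(3) by (simp add: p q)
      have lt: "a < b" "b < c" "a' < b'" "b' < c'"
        using pq(1,2) by (auto simp: sorted_triads_def p q)
      have "a' \<in> {a, b, c}" "b' \<in> {a, b, c}" "c' \<in> {a, b, c}"
        "a \<in> {a', b', c'}" "b \<in> {a', b', c'}" "c \<in> {a', b', c'}"
        using eq by blast+
      then have "a = a' \<and> b = b' \<and> c = c'" using lt by (simp; linarith)
      then show "p = q" by (simp add: p q)
    qed
    show "(\<lambda>(a, b, c). {a, b, c}) ` sorted_triads E = triangles V E"
    proof safe
      fix a b c assume st: "(a, b, c) \<in> sorted_triads E"
      then have "{a, b} \<subseteq> V" "{a, c} \<subseteq> V" 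
        using assms by (auto simp: sorted_triads_def triads_def)
      then show "{a, b, c} \<in> triangles V E"
        using st by (auto simp: sorted_triads_def triads_def triangles_def insert_commute)
    next
      fix S assume S: "S \<in> triangles V E"
      then have "card S = 3" by (simp add: triangles_def)
      then obtain x y z where xyz: "S = {x, y, z}" "x \<noteq> y" "x \<noteq> z" "y \<noteq> z"
        by (metis card_3_iff)
      have "\<exists>a b c. S = {a, b, c} \<and> a < b \<and> b < c"
      proof -
        consider "x < y \<and> y < z" | "x < z \<and> z < y" | "y < x \<and> x < z" | "y < z \<and> z < x"
          | "z < x \<and> x < y" | "z < y \<and> y < x"
          using xyz by linarith
        then show ?thesis using xyz(1) by cases (metis insert_commute)+
      qed
      then obtain a b c where abc: "S = {a, b, c}" "a < b" "b < c" by blast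
      then have "(a, b, c) \<in> sorted_triads E"
        using S by (simp add: triangles_def sorted_triads_def triads_def)
      then show "S \<in> (\<lambda>(a, b, c). {a, b, c}) ` sorted_triads E"
        using abc(1) by (intro image_eqI[of _ _ "(a, b, c)"]) simp_all
    qed
  qed
qed

lemma sum_card_common: "(\<Sum>(a, b)\<in>arcs E. real (card (common E a b))) = 6 * real (card (sorted_triads E))"
  using sum_arcs_common[of "\<lambda>_ _ _. 1::real"] card_triads by (simp add: case_prod_unfold)

lemma sum_degree: "(\<Sum>v\<in>\<Union>E. real (degree E v)) = 2 * real (card E)"
proof -
  have "arcs E = Sigma (\<Union>E) (neighbours E)"
    by (auto simp: arcs_def neighbours_def insert_commute)
  then have "real (card (arcs E)) = (\<Sum>v\<in>\<Union>E. real (degree E v))"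
    using finite_vertices finite_neighbours by (simp add: degree_def)
  then show ?thesis using card_arcs by simp
qed

end

locale oriented_edge_set = edge_set +
  fixes out :: "nat \<Rightarrow> nat set" and \<alpha> :: nat
  assumes finite_out: "finite (out a)" and card_out: "card (out a) \<le> \<alpha>"
    and out_cover: "{a, b} \<in> E \<Longrightarrow> b \<in> out a \<or> a \<in> out b"
begin

lemma sum_out_le:
  assumes "\<And>a. 0 \<le> f a"
  shows "(\<Sum>(a, b)\<in>{(a, b) \<in> arcs E. b \<in> out a}. f a) \<le> real \<alpha> * (\<Sum>a\<in>\<Union>E. f a)"
proof -
  have "(\<Sum>(a, b)\<in>{(a, b) \<in> arcs E. b \<in> out a}. f a) \<le> (\<Sum>(a, b)\<in>Sigma (\<Union>E) out. f a)"
    using assms finite_vertices finite_out by (intro sum_mono2) (auto simp: arcs_def)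
  also have "\<dots> = (\<Sum>a\<in>\<Union>E. \<Sum>b\<in>out a. f a)"
    using finite_vertices finite_out by (subst sum.Sigma) auto
  also have "\<dots> = (\<Sum>a\<in>\<Union>E. real (card (out a)) * f a)"
    by simp
  also have "\<dots> \<le> (\<Sum>a\<in>\<Union>E. real \<alpha> * f a)"
    using assms card_out by (intro sum_mono mult_right_mono) auto
  finally show ?thesis by (simp add: sum_distrib_left)
qed

text \<open>The minimum is at most the degree of the tail under the orientation, every vertex is the
  tail of at most \<open>\<alpha>\<close> arcs, and the degrees sum to \<open>2 * m\<close>. Each
  edge is counted in both directions, hence 4.\<close>

lemma sum_min_degree: "(\<Sum>(a, b)\<in>arcs E. real (min_degree E a b)) \<le> 4 * real \<alpha> * real (card E)"
proof -
  let ?d = "\<lambda>a b. if b \<in> out a then real (degree E a) else 0"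
  have "(\<Sum>(a, b)\<in>arcs E. real (min_degree E a b)) \<le> (\<Sum>(a, b)\<in>arcs E. ?d a b + ?d b a)"
  proof (intro sum_mono, clarify)
    fix a b assume "(a, b) \<in> arcs E"
    then have "b \<in> out a \<or> a \<in> out b" using out_cover by (simp add: arcs_def)
    then show "real (min_degree E a b) \<le> ?d a b + ?d b a" by (auto simp: min_degree_def)
  qed
  also have "\<dots> = (\<Sum>(a, b)\<in>arcs E. ?d a b) + (\<Sum>(a, b)\<in>arcs E. ?d b a)"
    by (simp add: sum.distrib case_prod_unfold)
  also have "(\<Sum>(a, b)\<in>arcs E. ?d b a) = (\<Sum>(a, b)\<in>arcs E. ?d a b)"
    by (rule sum_arcs_swap)
  also have "(\<Sum>(a, b)\<in>arcs E. ?d a b) = (\<Sum>(a, b)\<in>{(a, b) \<in> arcs E. b \<in> out a}. real (degree E a))"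
    by (rule sum.mono_neutral_cong_right) (auto simp: finite_arcs split: if_splits)
  also have "\<dots> \<le> real \<alpha> * (2 * real (card E))"
    using sum_out_le[of "\<lambda>a. real (degree E a)"] sum_degree by simp
  finally show ?thesis by simp
qed

text \<open>Every triangle contains a directed path \<open>a \<rightarrow> b \<rightarrow> c\<close>, and an arc \<open>a \<rightarrow> b\<close> extends to at most
  \<open>\<alpha>\<close> such paths.\<close>

lemma sum_sorted_triads_le:
  fixes f :: "nat \<Rightarrow> nat \<Rightarrow> real"
  assumes sym: "\<And>a b. f a b = f b a"
    and nonneg: "\<And>a b. {a, b} \<in> E \<Longrightarrow> 0 \<le> f a b"
    and le: "\<And>a b c. (a, b, c) \<in> sorted_triads E \<Longrightarrow>
      g a b c \<le> f a b \<and> g a b c \<le> f a c \<and> g a b c \<le> f b c"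
  shows "(\<Sum>(a, b, c)\<in>sorted_triads E. g a b c) \<le> real \<alpha> * (\<Sum>(a, b)\<in>arcs E. f a b)"
proof -
  let ?F = "\<lambda>a b c. if b \<in> out a \<and> c \<in> out b then f a b else 0"
  have "(\<Sum>(a, b, c)\<in>sorted_triads E. g a b c) \<le> (\<Sum>(a, b, c)\<in>sorted_triads E.
      ?F a b c + ?F a c b + ?F b a c + ?F b c a + ?F c a b + ?F c b a)"
  proof (intro sum_mono, clarify)
    fix a b c assume st: "(a, b, c) \<in> sorted_triads E"
    then have e: "{a, b} \<in> E" "{b, c} \<in> E" "{a, c} \<in> E"
      by (auto simp: sorted_triads_def triads_def)
    have nn: "0 \<le> ?F a b c" "0 \<le> ?F a c b" "0 \<le> ?F b a c" "0 \<le> ?F b c a" "0 \<le> ?F c a b" "0 \<le> ?F c b a"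
      using e[THEN nonneg] sym[of b a] sym[of c a] sym[of c b] by auto
    have g: "g a b c \<le> f a b" "g a b c \<le> f b a" "g a b c \<le> f a c"
      "g a b c \<le> f c a" "g a b c \<le> f b c" "g a b c \<le> f c b"
      using le[OF st] sym[of b a] sym[of c a] sym[of c b] by auto
    \<comment> \<open>Any orientation of a triangle, cyclic or not, has two consecutive arcs. The
      charge goes to the first of them, which may be any of the three edges; this is why
      \<open>le\<close> bounds \<open>g\<close> by \<open>f\<close> on all three.\<close>
    have "g a b c \<le> ?F a b c \<or> g a b c \<le> ?F a c b \<or> g a b c \<le> ?F b a c \<or>
        g a b c \<le> ?F b c a \<or> g a b c \<le> ?F c a b \<or> g a b c \<le> ?F c b a"
      using out_cover[OF e(1)] out_cover[OF e(2)] out_cover[OF e(3)] g by (simp) blast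
    then show "g a b c \<le> ?F a b c + ?F a c b + ?F b a c + ?F b c a + ?F c a b + ?F c b a"
      using nn by linarith
  qed
  also have "\<dots> = (\<Sum>(a, b)\<in>arcs E. \<Sum>c\<in>common E a b. ?F a b c)"
    by (simp only: sum_triads_sorted sum_arcs_common)
  also have "\<dots> \<le> (\<Sum>(a, b)\<in>arcs E. real \<alpha> * f a b)"
  proof (intro sum_mono, clarify)
    fix a b assume "(a, b) \<in> arcs E"
    then have nn: "0 \<le> f a b" by (auto simp: arcs_def nonneg)
    then have "(\<Sum>c\<in>common E a b. ?F a b c) \<le> (\<Sum>c\<in>common E a b. if c \<in> out b then f a b else 0)"
      by (intro sum_mono) auto
    also have "\<dots> = (\<Sum>c\<in>common E a b \<inter> out b. f a b)"
      by (rule sum.mono_neutral_cong_right) (auto simp: finite_common)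
    also have "\<dots> \<le> real (card (out b)) * f a b"
      using finite_out nn by (auto intro!: mult_right_mono card_mono)
    also have "\<dots> \<le> real \<alpha> * f a b"
      using card_out nn by (intro mult_right_mono) auto
    finally show "(\<Sum>c\<in>common E a b. ?F a b c) \<le> real \<alpha> * f a b" .
  qed
  finally show ?thesis by (simp add: sum_distrib_left case_prod_unfold)
qed

text \<open>The case \<open>f = g = 1\<close>. It justifies \<open>2 * m * \<alpha>\<close> as the
  starting guess of the search.\<close>

lemma triangles_le: "real (card (sorted_triads E)) \<le> 2 * real \<alpha> * real (card E)"
  using sum_sorted_triads_le[of "\<lambda>_ _. 1" "\<lambda>_ _ _. 1"] card_arcs by (simp add: case_prod_unfold)

end

section \<open>Testing and probing edges\<close>

text \<open>With \<open>s = blocks d k\<close> probes into a range of exactly \<open>s * k\<close>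
  positions, each triangle is hit \<open>1 / k\<close> times in expectation, with no rounding
  error.\<close>

definition blocks :: "nat \<Rightarrow> nat \<Rightarrow> nat" where
  "blocks d k = nat \<lceil>real d / real k\<rceil>"

lemma real_nat_ceiling_le: "0 \<le> x \<Longrightarrow> real (nat \<lceil>x\<rceil>) \<le> x + 1"
proof -
  assume "0 \<le> x"
  then have "0 \<le> \<lceil>x\<rceil>" by (simp add: zero_le_ceiling less_le_trans[of "-1" 0])
  then show ?thesis
    using of_int_ceiling_le_add_one[of x] by (simp add: of_nat_nat)
qed

lemma blocks_le: "real (blocks d k) \<le> real d / real k + 1"
  unfolding blocks_def by (intro real_nat_ceiling_le) simp

lemma blocks_ge: "0 < k \<Longrightarrow> d \<le> blocks d k * k"
proof -
  assume "0 < k"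
  have "real d / real k \<le> real (blocks d k)"
    unfolding blocks_def by (simp add: of_nat_nat)
  then have "real d \<le> real (blocks d k * k)" using \<open>0 < k\<close> by (simp add: field_simps)
  then show ?thesis by linarith
qed

lemma blocks_pos: "0 < k \<Longrightarrow> 0 < d \<Longrightarrow> 0 < blocks d k"
  by (metis blocks_ge bot_nat_0.not_eq_extremum le_zero_eq mult_0)

text \<open>An index drawn from \<open>{..<M}\<close> hits each triangle on \<open>{u, v}\<close> with probability \<open>1 / M\<close>; indices
  beyond the degree of \<open>u\<close> are wasted.\<close>

definition probe :: "nat \<Rightarrow> nat \<Rightarrow> nat \<Rightarrow> (nat \<Rightarrow> algorithm) \<Rightarrow> algorithm \<Rightarrow> algorithm" where
  "probe M u v g h = Toss (pmf_of_set {..<M}) (\<lambda>j. Neighbour u j (\<lambda>x.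
     case x of None \<Rightarrow> h | Some w \<Rightarrow> Edge v w (\<lambda>b. if b then g w else h)))"

text \<open>Output 1 means light (no hit), 0 means heavy. Stopping at the first hit is what makes
  tests of edges in many triangles cheap.\<close>

primrec test_loop :: "nat \<Rightarrow> nat \<Rightarrow> nat \<Rightarrow> nat \<Rightarrow> algorithm" where
  "test_loop M u v 0 = Output 1"
| "test_loop M u v (Suc k) = probe M u v (\<lambda>_. Output 0) (test_loop M u v k)"

text \<open>The expected number of hits, if the loop did not stop, would be
  \<open>t / \<tau>\<close> for an edge in \<open>t\<close> triangles, so \<open>\<tau>\<close> acts
  as a soft threshold.\<close>

definition edge_test :: "nat \<Rightarrow> nat \<Rightarrow> nat \<Rightarrow> algorithm" where
  "edge_test \<tau> a b = Degree a (\<lambda>da. Degree b (\<lambda>db.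
     let s = blocks (min da db) \<tau>
     in if da \<le> db then test_loop (s * \<tau>) a b s else test_loop (s * \<tau>) b a s))"

definition check :: "nat \<Rightarrow> nat \<Rightarrow> nat \<Rightarrow> nat \<Rightarrow> algorithm" where
  "check \<tau> x y w =
     bind_alg (if x < w then edge_test \<tau> y w else Output 0) (\<lambda>a.
     bind_alg (if y < w then edge_test \<tau> x w else Output 0) (\<lambda>b.
     Output ((1 - a) * (1 - b))))"

definition triangle_probe :: "nat \<Rightarrow> nat \<Rightarrow> nat \<Rightarrow> nat \<Rightarrow> algorithm" where
  "triangle_probe M \<tau> x y = probe M x y (check \<tau> x y) (Output 0)"

primrec sum_of :: "nat \<Rightarrow> algorithm \<Rightarrow> algorithm" where
  "sum_of 0 A = Output 0"
| "sum_of (Suc k) A = bind_alg A (\<lambda>z. bind_alg (sum_of k A) (\<lambda>s. Output (z + s)))"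

text \<open>Each of the \<open>r\<close> probes hits a given triangle with probability
  \<open>1 / (r * \<alpha>)\<close>; the factor \<open>\<alpha>\<close> makes the result
  unbiased.\<close>

definition probe_edge :: "nat \<Rightarrow> nat \<Rightarrow> nat \<Rightarrow> nat \<Rightarrow> algorithm" where
  "probe_edge \<tau> \<alpha> a b = Degree a (\<lambda>da. Degree b (\<lambda>db.
     let r = blocks (min da db) \<alpha>
     in bind_alg (sum_of r (if da \<le> db then triangle_probe (r * \<alpha>) \<tau> a b
                                      else triangle_probe (r * \<alpha>) \<tau> b a))
          (\<lambda>s. Output (real \<alpha> * s))))"

definition sampling_round :: "nat \<Rightarrow> nat \<Rightarrow> algorithm" where
  "sampling_round \<tau> \<alpha> = RandomEdge (\<lambda>e.
     bind_alg (edge_test \<tau> (Min e) (Max e))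
       (\<lambda>l. if l = 1 then probe_edge \<tau> \<alpha> (Min e) (Max e) else Output 0))"

lemma set_pmf_uniform: "0 < (M::nat) \<Longrightarrow> set_pmf (pmf_of_set {..<M}) = {..<M}"
  by (simp add: lessThan_empty_iff)

lemma finite_tosses_probe:
  assumes "0 < M" "\<And>w. finite_tosses (g w)" "finite_tosses h"
  shows "finite_tosses (probe M u v g h)"
  using assms by (simp add: probe_def set_pmf_uniform split: option.split)

lemma finite_tosses_test_loop: "0 < M \<Longrightarrow> finite_tosses (test_loop M u v k)"
  by (induction k) (simp_all add: finite_tosses_probe)

lemma finite_tosses_edge_test:
  assumes "0 < \<tau>"
  shows "finite_tosses (edge_test \<tau> a b)"
proof -
  have "finite_tosses (test_loop (s * \<tau>) u v s)" for s u v
    using assms finite_tosses_test_loop[of "s * \<tau>" u v s] by (cases s) auto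
  then show ?thesis by (simp add: edge_test_def Let_def)
qed

lemma finite_tosses_check: "0 < \<tau> \<Longrightarrow> finite_tosses (check \<tau> x y w)"
  by (simp add: check_def finite_tosses_bind finite_tosses_edge_test)

lemma finite_tosses_triangle_probe: "0 < M \<Longrightarrow> 0 < \<tau> \<Longrightarrow> finite_tosses (triangle_probe M \<tau> x y)"
  by (simp add: triangle_probe_def finite_tosses_probe finite_tosses_check)

lemma finite_tosses_sum_of: "finite_tosses A \<Longrightarrow> finite_tosses (sum_of k A)"
  by (induction k) (simp_all add: finite_tosses_bind)

lemma finite_tosses_sampling_round:
  assumes "0 < \<tau>" "0 < \<alpha>"
  shows "finite_tosses (sampling_round \<tau> \<alpha>)"
proof -
  \<comment> \<open>All conceivable answers to the degree queries are covered here, so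
    \<open>r = 0\<close> occurs; \<open>sum_of 0\<close> then never tosses from the empty
    range.\<close>
  have "finite_tosses (sum_of r (triangle_probe (r * \<alpha>) \<tau> a b))" for r a b
  proof (cases "r = 0")
    case False
    then show ?thesis using assms by (intro finite_tosses_sum_of finite_tosses_triangle_probe) auto
  qed simp
  then show ?thesis
    using assms by (auto simp: sampling_round_def probe_edge_def Let_def finite_tosses_edge_test
        intro!: finite_tosses_bind)
qed

text \<open>The probability that \<open>edge_test\<close> outputs 1: all \<open>s\<close>
  independent probes miss, each hitting with probability \<open>t / (s * \<tau>)\<close>.\<close>

definition light_prob :: "nat set set \<Rightarrow> nat \<Rightarrow> nat \<Rightarrow> nat \<Rightarrow> real" where
  "light_prob E \<tau> a b = (let s = blocks (min_degree E a b) \<tau> in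
     (1 - real (card (common E a b)) / (real s * real \<tau>)) ^ s)"

definition credit_prob :: "nat set set \<Rightarrow> nat \<Rightarrow> nat \<Rightarrow> nat \<Rightarrow> nat \<Rightarrow> real" where
  "credit_prob E \<tau> x y w = (if x < w then 1 - light_prob E \<tau> y w else 1) *
     (if y < w then 1 - light_prob E \<tau> x w else 1)"

lemma light_prob_commute: "light_prob E \<tau> a b = light_prob E \<tau> b a"
  by (simp add: light_prob_def common_commute min_degree_commute)

lemma credit_prob_commute: "credit_prob E \<tau> x y w = credit_prob E \<tau> y x w"
  by (simp add: credit_prob_def)

section \<open>Output distributions and expected costs of tests and probes\<close>

locale query_model = oriented_edge_set +
  fixes nb :: "nat \<Rightarrow> nat \<Rightarrow> nat"
  assumes nb_bij: "v \<in> \<Union>E \<Longrightarrow> bij_betw (nb v) {..<degree E v} (neighbours E v)"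
    and edges_nonempty: "E \<noteq> {}"
begin

abbreviation "ex \<equiv> expect E nb"
abbreviation "cost A \<equiv> expect E nb A (\<lambda>_. 0) 1"
abbreviation "m \<equiv> real (card E)"
abbreviation "tri \<equiv> real (card (sorted_triads E))"

lemma m_pos: "0 < m"
  using edges_nonempty finite_edges by (simp add: card_gt_0_iff)

lemma cost_nonneg: "0 \<le> cost A"
  by (rule expect_nonneg) auto

lemma cost_bind: "cost (bind_alg A g) = cost A + ex A (\<lambda>x. cost (g x)) 0"
  by (subst expect_bind, subst expect_split) simp

lemma ex_const: "finite_tosses A \<Longrightarrow> ex A (\<lambda>_. a) 0 = a"
  by (rule expect_const[OF _ finite_edges edges_nonempty])

lemma degree_pos: "{a, b} \<in> E \<Longrightarrow> 0 < degree E a"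
  using finite_neighbours[of a] by (auto simp: degree_def neighbours_def card_gt_0_iff insert_commute)

lemma min_degree_pos: "{a, b} \<in> E \<Longrightarrow> 0 < min_degree E a b"
  using degree_pos[of a b] degree_pos[of b a] by (auto simp: min_degree_def insert_commute)

text \<open>The \<open>Neighbour\<close> query is always paid, the \<open>Edge\<close> query only
  for an index below the degree. \<open>nb_bij\<close> turns the sum over indices into one over
  neighbours, whatever their order.\<close>

lemma expect_probe:
  assumes "u \<in> \<Union>E" "degree E u \<le> M" "0 < M"
  shows "ex (probe M u v g h) F c = c * (1 + real (degree E u) / real M) +
    (\<Sum>w\<in>common E u v. ex (g w) F c) / real M +
    (1 - real (card (common E u v)) / real M) * ex h F c"
proof -
  let ?H = "ex h F c" and ?d = "degree E u"
  \<comment> \<open>Every index contributes the baseline \<open>c + ?H\<close>; \<open>?G w\<close>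
    is the surplus of an index that holds the neighbour \<open>w\<close>.\<close>
  let ?G = "\<lambda>w. c + (if {v, w} \<in> E then ex (g w) F c - ?H else 0)"
  have "ex (probe M u v g h) F c =
      (\<Sum>j<M. (c + ?H + (if j < ?d then ?G (nb u j) else 0)) / real M)"
    unfolding probe_def expect.simps set_pmf_uniform[OF assms(3)]
    using assms by (intro sum.cong) (auto simp: neighbour_answer_def field_simps lessThan_empty_iff)
  also have "\<dots> = (real M * (c + ?H) + (\<Sum>j<M. if j < ?d then ?G (nb u j) else 0)) / real M"
    by (simp add: sum_divide_distrib[symmetric] sum.distrib)
  also have "(\<Sum>j<M. if j < ?d then ?G (nb u j) else 0) = (\<Sum>j<?d. ?G (nb u j))"
    using assms by (intro sum.mono_neutral_cong_right) auto
  also have "\<dots> = (\<Sum>w\<in>neighbours E u. ?G w)"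
    by (rule sum.reindex_bij_betw[OF nb_bij[OF assms(1)]])
  also have "\<dots> = real ?d * c + (\<Sum>w\<in>neighbours E u. if {v, w} \<in> E then ex (g w) F c - ?H else 0)"
    by (simp add: sum.distrib degree_def)
  also have "(\<Sum>w\<in>neighbours E u. if {v, w} \<in> E then ex (g w) F c - ?H else 0) =
      (\<Sum>w\<in>common E u v. ex (g w) F c - ?H)"
  proof -
    have "common E u v = {w \<in> neighbours E u. {v, w} \<in> E}"
      by (auto simp: common_def neighbours_def insert_commute)
    then show ?thesis by (simp add: sum.inter_filter[OF finite_neighbours])
  qed
  also have "\<dots> = (\<Sum>w\<in>common E u v. ex (g w) F c) - real (card (common E u v)) * ?H"
    by (simp add: sum_subtractf)
  finally show ?thesis
    using assms(3) by (simp add: add_divide_distrib diff_divide_distrib algebra_simps)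
qed

lemma expect_test_loop:
  assumes "u \<in> \<Union>E" "degree E u \<le> M" "0 < M"
  shows "ex (test_loop M u v k) F 0 =
    (1 - real (card (common E u v)) / real M) ^ k * F 1 +
    (1 - (1 - real (card (common E u v)) / real M) ^ k) * F 0"
proof (induction k)
  case (Suc k)
  show ?case
    unfolding test_loop.simps expect_probe[OF assms] Suc
    by (simp add: algebra_simps add_divide_distrib)
qed simp

text \<open>A probe asks at most 2 queries. The second bound reflects the expected waiting time
  \<open>M / t\<close> for a hit; its right-hand side is the fixed point of
  \<open>x = 2 * t + (1 - t / M) * x\<close>.\<close>

lemma cost_test_loop:
  assumes "u \<in> \<Union>E" "degree E u \<le> M" "0 < M"
  shows "cost (test_loop M u v k) \<le> 2 * real k"
    and "real (card (common E u v)) * cost (test_loop M u v k) \<le> 2 * real M"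
proof -
  let ?t = "real (card (common E u v))"
  have "card (common E u v) \<le> degree E u"
    unfolding common_def degree_def by (intro card_mono finite_neighbours) auto
  then have tM: "?t \<le> real M" using assms by simp
  have step: "cost (test_loop M u v (Suc k)) \<le> 2 + (1 - ?t / real M) * cost (test_loop M u v k)" for k
    using assms by (simp add: expect_probe[OF assms])
  show "cost (test_loop M u v k) \<le> 2 * real k"
  proof (induction k)
    case (Suc k)
    have "(1 - ?t / real M) * cost (test_loop M u v k) \<le> 1 * cost (test_loop M u v k)"
      using cost_nonneg by (intro mult_right_mono) auto
    then show ?case using Suc step[of k] by simp
  qed simp
  show "?t * cost (test_loop M u v k) \<le> 2 * real M"
  proof (induction k)
    case (Suc k)
    have "?t * cost (test_loop M u v (Suc k)) \<le>
        ?t * (2 + (1 - ?t / real M) * cost (test_loop M u v k))"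
      by (intro mult_left_mono step) simp
    also have "\<dots> = 2 * ?t + (1 - ?t / real M) * (?t * cost (test_loop M u v k))"
      by (simp add: algebra_simps)
    also have "\<dots> \<le> 2 * ?t + (1 - ?t / real M) * (2 * real M)"
      using Suc tM assms by (intro add_left_mono mult_left_mono) auto
    also have "\<dots> = 2 * real M" using assms by (simp add: field_simps)
    finally show ?case .
  qed simp
qed

lemma edge_test_cases:
  assumes "{a, b} \<in> E"
  obtains u v where "{u, v} = {a, b}" "u \<in> \<Union>E" "degree E u = min_degree E a b"
    "common E u v = common E a b"
    "\<And>\<tau> F c. ex (edge_test \<tau> a b) F c = 2 * c +
       ex (test_loop (blocks (min_degree E a b) \<tau> * \<tau>) u v (blocks (min_degree E a b) \<tau>)) F c"
proof (cases "degree E a \<le> degree E b")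
  case True
  then show ?thesis using that[of a b] assms
    by (auto simp: edge_test_def Let_def min_degree_def)
next
  case False
  then show ?thesis using that[of b a] assms
    by (auto simp: edge_test_def Let_def min_degree_def common_commute)
qed

lemma expect_edge_test:
  assumes "{a, b} \<in> E" "0 < \<tau>"
  shows "ex (edge_test \<tau> a b) F 0 = light_prob E \<tau> a b * F 1 + (1 - light_prob E \<tau> a b) * F 0"
proof -
  let ?s = "blocks (min_degree E a b) \<tau>"
  obtain u v where uv: "{u, v} = {a, b}" "u \<in> \<Union>E" "degree E u = min_degree E a b"
    "common E u v = common E a b"
    "\<And>\<tau> F c. ex (edge_test \<tau> a b) F c = 2 * c +
       ex (test_loop (blocks (min_degree E a b) \<tau> * \<tau>) u v (blocks (min_degree E a b) \<tau>)) F c"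
    using edge_test_cases[OF assms(1)] by metis
  have "0 < ?s * \<tau>" "degree E u \<le> ?s * \<tau>"
    using assms min_degree_pos by (auto simp: uv(3) blocks_pos blocks_ge)
  then show ?thesis
    by (simp add: uv(5) expect_test_loop[OF uv(2)] uv(4) light_prob_def Let_def)
qed

text \<open>The first bound pays for testing the sampled edge. The second, weighted by the number of
  triangles on the edge, pays for the tests in credit checks, see
  \<open>sum_check_cost\<close>.\<close>

lemma cost_edge_test:
  assumes "{a, b} \<in> E" "0 < \<tau>"
  shows "cost (edge_test \<tau> a b) \<le> 4 + 2 * real (min_degree E a b) / real \<tau>" (is ?bound1)
    and "real (card (common E a b)) * cost (edge_test \<tau> a b) \<le>
      4 * real (card (common E a b)) + 4 * real (min_degree E a b)" (is ?bound2)
proof -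
  let ?s = "blocks (min_degree E a b) \<tau>" and ?t = "real (card (common E a b))"
  let ?d = "real (min_degree E a b)"
  obtain u v where uv: "{u, v} = {a, b}" "u \<in> \<Union>E" "degree E u = min_degree E a b"
    "common E u v = common E a b"
    "\<And>\<tau> F c. ex (edge_test \<tau> a b) F c = 2 * c +
       ex (test_loop (blocks (min_degree E a b) \<tau> * \<tau>) u v (blocks (min_degree E a b) \<tau>)) F c"
    using edge_test_cases[OF assms(1)] by metis
  have M: "degree E u \<le> ?s * \<tau>" "0 < ?s * \<tau>"
    using assms min_degree_pos by (auto simp: uv(3) blocks_pos blocks_ge)
  let ?C = "cost (test_loop (?s * \<tau>) u v ?s)"
  have C1: "?C \<le> 2 * real ?s" and C2: "?t * ?C \<le> 2 * real (?s * \<tau>)"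
    using cost_test_loop[OF uv(2) M, of v ?s] by (simp_all add: uv(4))
  show ?bound1
    using C1 blocks_le[of "min_degree E a b" \<tau>] uv(5)[of \<tau> "\<lambda>_. 0" 1] by simp
  have "?t * ?C \<le> 2 * ?t + 4 * ?d"
  \<comment> \<open>For a single block the range \<open>\<tau>\<close> may far exceed the degree,
    but the loop is then one probe of cost at most 2. With two or more blocks, rounding up at most
    doubles \<open>d / \<tau>\<close>.\<close>
  proof (cases "?s = 1")
    case True
    then have "?t * ?C \<le> ?t * 2" using C1 by (intro mult_left_mono) auto
    then show ?thesis by simp
  next
    case False
    then have "2 \<le> real ?s" using M(2) by (cases ?s) auto
    then have "1 \<le> ?d / real \<tau>" using blocks_le[of "min_degree E a b" \<tau>] by linarith
    then have "real ?s \<le> 2 * (?d / real \<tau>)" using blocks_le[of "min_degree E a b" \<tau>] by linarith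
    then have "real (?s * \<tau>) \<le> 2 * ?d" using assms(2) by (simp add: field_simps)
    then show ?thesis using C2 by linarith
  qed
  moreover have "?t * cost (edge_test \<tau> a b) = 2 * ?t + ?t * ?C"
    by (simp add: uv(5) algebra_simps)
  ultimately show ?bound2 by linarith
qed

section \<open>Bounds on the light probability, and moments of the edge probes\<close>

lemma light_prob_base:
  assumes "{a, b} \<in> E" "0 < \<tau>"
  defines "s \<equiv> blocks (min_degree E a b) \<tau>"
  shows "0 < s" "real (card (common E a b)) / (real s * real \<tau>) \<le> 1"
proof -
  show s: "0 < s" unfolding s_def using assms by (intro blocks_pos min_degree_pos)
  have "card (common E a b) \<le> s * \<tau>"
    using card_common_le[of a b] blocks_ge[OF assms(2), of "min_degree E a b"] by (simp add: s_def)
  then have "real (card (common E a b)) \<le> real s * real \<tau>" by (metis of_nat_le_iff of_nat_mult)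
  then show "real (card (common E a b)) / (real s * real \<tau>) \<le> 1"
    using s assms(2) by (simp add: field_simps)
qed

lemma light_prob_bounds:
  assumes "{a, b} \<in> E" "0 < \<tau>"
  shows "0 \<le> light_prob E \<tau> a b" "light_prob E \<tau> a b \<le> 1"
  using light_prob_base(2)[OF assms] by (auto simp: light_prob_def Let_def intro!: power_le_one)

text \<open>Bernoulli's inequality, or the union bound over the probes. It keeps the bias
  small.\<close>

lemma heavy_prob_le:
  assumes "{a, b} \<in> E" "0 < \<tau>"
  shows "1 - light_prob E \<tau> a b \<le> real (card (common E a b)) / real \<tau>"
proof -
  let ?s = "blocks (min_degree E a b) \<tau>"
  let ?x = "real (card (common E a b)) / (real ?s * real \<tau>)"
  have "1 + real ?s * (- ?x) \<le> (1 + (- ?x)) ^ ?s"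
    using light_prob_base(2)[OF assms] by (intro Bernoulli_inequality) simp
  moreover have "real ?s * ?x = real (card (common E a b)) / real \<tau>"
    using light_prob_base(1)[OF assms] by simp
  ultimately show ?thesis by (simp add: light_prob_def Let_def)
qed

text \<open>From \<open>1 - x \<le> exp (- x)\<close> and \<open>y * exp (- y) \<le> 1\<close> with
  \<open>y = t / \<tau>\<close>. It limits what heavy edges add to the second moment.\<close>

lemma light_prob_mult_le:
  assumes "{a, b} \<in> E" "0 < \<tau>"
  shows "light_prob E \<tau> a b * real (card (common E a b)) \<le> real \<tau>"
proof -
  let ?s = "blocks (min_degree E a b) \<tau>" and ?t = "real (card (common E a b))"
  let ?x = "?t / (real ?s * real \<tau>)"
  have "light_prob E \<tau> a b \<le> exp (- ?x) ^ ?s"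
    unfolding light_prob_def Let_def using light_prob_base(2)[OF assms] exp_ge_add_one_self[of "- ?x"]
    by (intro power_mono) auto
  also have "\<dots> = exp (- (?t / real \<tau>))"
    using light_prob_base(1)[OF assms] by (simp flip: exp_of_nat_mult)
  finally have le: "light_prob E \<tau> a b * (?t / real \<tau>) \<le> exp (- (?t / real \<tau>)) * (?t / real \<tau>)"
    by (intro mult_right_mono) auto
  have "?t / real \<tau> \<le> exp (?t / real \<tau>)"
    using exp_ge_add_one_self[of "?t / real \<tau>"] by linarith
  then have "exp (- (?t / real \<tau>)) * (?t / real \<tau>) \<le> exp (- (?t / real \<tau>)) * exp (?t / real \<tau>)"
    by (rule mult_left_mono) simp
  also have "\<dots> = 1" by (simp flip: exp_add)
  finally have "light_prob E \<tau> a b * (?t / real \<tau>) \<le> 1" using le by linarith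
  then show ?thesis using assms(2) by (simp add: field_simps)
qed

lemma credit_prob_bounds:
  assumes "{x, y} \<in> E" "w \<in> common E x y" "0 < \<tau>"
  shows "0 \<le> credit_prob E \<tau> x y w" "credit_prob E \<tau> x y w \<le> 1"
proof -
  have "{y, w} \<in> E" "{x, w} \<in> E"
    using assms(2) by (auto simp: common_def neighbours_def insert_commute)
  then show "0 \<le> credit_prob E \<tau> x y w" "credit_prob E \<tau> x y w \<le> 1"
    using light_prob_bounds[of y w \<tau>] light_prob_bounds[of x w \<tau>] assms(3)
    by (auto simp: credit_prob_def intro: mult_le_one)
qed

lemma expect_check:
  assumes "{y, w} \<in> E" "{x, w} \<in> E" "0 < \<tau>"
  shows "ex (check \<tau> x y w) F 0 =
    credit_prob E \<tau> x y w * F 1 + (1 - credit_prob E \<tau> x y w) * F 0"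
  using assms by (simp add: check_def credit_prob_def expect_bind expect_edge_test algebra_simps)

lemma cost_check:
  assumes "{y, w} \<in> E" "{x, w} \<in> E" "0 < \<tau>"
  shows "cost (check \<tau> x y w) \<le> cost (edge_test \<tau> y w) + cost (edge_test \<tau> x w)"
  using assms cost_nonneg[of "edge_test \<tau> y w"] cost_nonneg[of "edge_test \<tau> x w"]
  by (auto simp: check_def cost_bind ex_const finite_tosses_edge_test)

definition credit :: "nat \<Rightarrow> nat \<Rightarrow> nat \<Rightarrow> real" where
  "credit \<tau> x y = (\<Sum>w\<in>common E x y. credit_prob E \<tau> x y w)"

text \<open>Both tests are charged, even where \<open>check\<close> skips one. The resulting upper
  bound is symmetric, and its sum over arcs can be rearranged by permuting triads.\<close>

definition check_cost :: "nat \<Rightarrow> nat \<Rightarrow> nat \<Rightarrow> real" where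
  "check_cost \<tau> x y = (\<Sum>w\<in>common E x y. cost (edge_test \<tau> y w) + cost (edge_test \<tau> x w))"

lemma credit_commute: "credit \<tau> x y = credit \<tau> y x"
  by (simp add: credit_def common_commute[of E x y] credit_prob_commute[of E \<tau> x y])

lemma check_cost_commute: "check_cost \<tau> x y = check_cost \<tau> y x"
  unfolding check_cost_def by (subst common_commute) (simp add: add.commute)

lemma credit_bounds:
  assumes "{x, y} \<in> E" "0 < \<tau>"
  shows "0 \<le> credit \<tau> x y" "credit \<tau> x y \<le> real (card (common E x y))"
proof -
  show "0 \<le> credit \<tau> x y"
    unfolding credit_def using credit_prob_bounds assms by (intro sum_nonneg) auto
  have "credit \<tau> x y \<le> (\<Sum>w\<in>common E x y. 1)"
    unfolding credit_def using credit_prob_bounds assms by (intro sum_mono) auto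
  then show "credit \<tau> x y \<le> real (card (common E x y))" by simp
qed

text \<open>A Bernoulli variable with parameter \<open>credit / M\<close>; in particular mean and
  second moment agree.\<close>

lemma expect_triangle_probe:
  assumes "{x, y} \<in> E" "degree E x \<le> M" "0 < M" "0 < \<tau>"
  shows "ex (triangle_probe M \<tau> x y) F 0 =
    credit \<tau> x y / real M * F 1 + (1 - credit \<tau> x y / real M) * F 0"
proof -
  have x: "x \<in> \<Union>E" using assms by auto
  have "(\<Sum>w\<in>common E x y. ex (check \<tau> x y w) F 0) =
      (\<Sum>w\<in>common E x y. credit_prob E \<tau> x y w * F 1 + (1 - credit_prob E \<tau> x y w) * F 0)"
    using assms by (intro sum.cong expect_check) (auto simp: common_def neighbours_def insert_commute)
  also have "\<dots> = credit \<tau> x y * F 1 + (real (card (common E x y)) - credit \<tau> x y) * F 0"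
    by (simp add: credit_def sum.distrib sum_subtractf flip: sum_distrib_right)
  finally have S: "(\<Sum>w\<in>common E x y. ex (check \<tau> x y w) F 0) =
      credit \<tau> x y * F 1 + (real (card (common E x y)) - credit \<tau> x y) * F 0" .
  show ?thesis
    unfolding triangle_probe_def expect_probe[OF x assms(2,3)] S
    by (simp add: add_divide_distrib diff_divide_distrib algebra_simps)
qed

lemma cost_triangle_probe:
  assumes "{x, y} \<in> E" "degree E x \<le> M" "0 < M" "0 < \<tau>"
  shows "cost (triangle_probe M \<tau> x y) \<le> 2 + check_cost \<tau> x y / real M"
proof -
  have x: "x \<in> \<Union>E" using assms by auto
  have "(\<Sum>w\<in>common E x y. cost (check \<tau> x y w)) \<le> check_cost \<tau> x y"
    unfolding check_cost_def using assms
    by (intro sum_mono cost_check) (auto simp: common_def neighbours_def insert_commute)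
  then have "(\<Sum>w\<in>common E x y. cost (check \<tau> x y w)) / real M \<le> check_cost \<tau> x y / real M"
    by (simp add: divide_right_mono)
  moreover have "real (degree E x) / real M \<le> 1" using assms by simp
  ultimately show ?thesis
    unfolding triangle_probe_def expect_probe[OF x assms(2,3)] by simp
qed

lemma cost_sum_of: "finite_tosses A \<Longrightarrow> cost (sum_of k A) = real k * cost A"
  by (induction k) (simp_all add: cost_bind ex_const finite_tosses_sum_of algebra_simps)

text \<open>The shift \<open>a\<close>, here and for the square below, absorbs the first outcome and
  lets the induction pass to the remaining summands.\<close>

lemma expect_sum_of:
  assumes "finite_tosses A"
  shows "ex (sum_of k A) (\<lambda>s. s + a) 0 = real k * ex A (\<lambda>z. z) 0 + a"
proof (induction k arbitrary: a)
  case (Suc k)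
  have "ex (sum_of (Suc k) A) (\<lambda>s. s + a) 0 = ex A (\<lambda>z. ex (sum_of k A) (\<lambda>s. s + (z + a)) 0) 0"
    by (simp add: expect_bind algebra_simps)
  also have "\<dots> = ex A (\<lambda>z. z + (real k * ex A (\<lambda>z. z) 0 + a)) 0"
    unfolding Suc by (simp add: algebra_simps)
  also have "\<dots> = ex A (\<lambda>z. z) 0 + (real k * ex A (\<lambda>z. z) 0 + a)"
    by (simp only: expect_add0 ex_const[OF assms])
  finally show ?case by (simp add: algebra_simps)
qed simp

lemma expect_sum_of_square:
  assumes "finite_tosses A"
  defines "\<mu> \<equiv> ex A (\<lambda>z. z) 0" and "v \<equiv> ex A (\<lambda>z. z\<^sup>2) 0"
  shows "ex (sum_of k A) (\<lambda>s. (s + a)\<^sup>2) 0 = real k * (v - \<mu>\<^sup>2) + (real k * \<mu> + a)\<^sup>2"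
proof (induction k arbitrary: a)
  case (Suc k)
  have "ex (sum_of (Suc k) A) (\<lambda>s. (s + a)\<^sup>2) 0 =
      ex A (\<lambda>z. ex (sum_of k A) (\<lambda>s. (s + (z + a))\<^sup>2) 0) 0"
    by (simp add: expect_bind algebra_simps)
  also have "\<dots> = ex A (\<lambda>z. z\<^sup>2 + (2 * (real k * \<mu> + a) * z + (real k * (v - \<mu>\<^sup>2) + (real k * \<mu> + a)\<^sup>2))) 0"
    unfolding Suc
    by (rule arg_cong[of _ _ "\<lambda>F. ex A F 0"], rule ext) (simp add: algebra_simps power2_eq_square)
  also have "\<dots> = v + (2 * (real k * \<mu> + a) * \<mu> + (real k * (v - \<mu>\<^sup>2) + (real k * \<mu> + a)\<^sup>2))"
    by (simp only: expect_add0 expect_mult0 ex_const[OF assms(1)] v_def \<mu>_def)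
  also have "\<dots> = real (Suc k) * (v - \<mu>\<^sup>2) + (real (Suc k) * \<mu> + a)\<^sup>2"
    by (simp add: algebra_simps power2_eq_square)
  finally show ?case .
qed simp

lemma min_max_edge:
  assumes "e \<in> E"
  shows "{Min e, Max e} \<in> E"
proof -
  obtain a b where "e = {a, b}" using card_edge[OF assms] by (meson card_2_iff)
  then have "{Min e, Max e} = e" by (auto simp: min_def max_def insert_commute)
  then show ?thesis using assms by simp
qed

lemma probe_edge_cases:
  assumes "{a, b} \<in> E"
  obtains u v where "{u, v} \<in> E" "degree E u = min_degree E a b"
    "\<And>\<tau>. credit \<tau> u v = credit \<tau> a b" "\<And>\<tau>. check_cost \<tau> u v = check_cost \<tau> a b"
    "\<And>\<tau> \<alpha> F c. ex (probe_edge \<tau> \<alpha> a b) F c = 2 * c + ex (bind_alg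
       (sum_of (blocks (min_degree E a b) \<alpha>) (triangle_probe (blocks (min_degree E a b) \<alpha> * \<alpha>) \<tau> u v))
       (\<lambda>s. Output (real \<alpha> * s))) F c"
proof (cases "degree E a \<le> degree E b")
  case True
  then show ?thesis using that[of a b] assms
    by (auto simp: probe_edge_def Let_def min_degree_def)
next
  case False
  then show ?thesis using that[of b a] assms
    by (auto simp: probe_edge_def Let_def min_degree_def credit_commute check_cost_commute insert_commute)
qed

text \<open>The output is \<open>k\<close> times a sum of \<open>r\<close> independent Bernoulli
  variables of mean \<open>\<mu>\<close>, where \<open>k * r * \<mu> = credit\<close>. Its variance
  is thus at most \<open>k\<^sup>2 * r * \<mu> = k * credit\<close>.\<close>

lemma probe_edge_moments:
  assumes "{a, b} \<in> E" "0 < \<tau>" "0 < k"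
  shows "ex (probe_edge \<tau> k a b) (\<lambda>z. z) 0 = credit \<tau> a b"
    and "ex (probe_edge \<tau> k a b) (\<lambda>z. z\<^sup>2) 0 \<le> real k * credit \<tau> a b + (credit \<tau> a b)\<^sup>2"
    and "cost (probe_edge \<tau> k a b) \<le>
      4 + 2 * real (min_degree E a b) / real k + check_cost \<tau> a b / real k"
proof -
  let ?r = "blocks (min_degree E a b) k"
  obtain u v where uv: "{u, v} \<in> E" "degree E u = min_degree E a b"
    "\<And>\<tau>. credit \<tau> u v = credit \<tau> a b" "\<And>\<tau>. check_cost \<tau> u v = check_cost \<tau> a b"
    "\<And>\<tau> \<alpha> F c. ex (probe_edge \<tau> \<alpha> a b) F c = 2 * c + ex (bind_alg
       (sum_of (blocks (min_degree E a b) \<alpha>) (triangle_probe (blocks (min_degree E a b) \<alpha> * \<alpha>) \<tau> u v))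
       (\<lambda>s. Output (real \<alpha> * s))) F c"
    using probe_edge_cases[OF assms(1)] by metis
  have r: "0 < ?r" using assms by (intro blocks_pos min_degree_pos)
  have M: "degree E u \<le> ?r * k" "0 < ?r * k"
    using r assms by (auto simp: uv(2) blocks_ge)
  let ?A = "triangle_probe (?r * k) \<tau> u v" and ?\<mu> = "credit \<tau> a b / real (?r * k)"
  have fin: "finite_tosses ?A" using M assms by (intro finite_tosses_triangle_probe)
  have mu: "ex ?A (\<lambda>z. z) 0 = ?\<mu>" "ex ?A (\<lambda>z. z\<^sup>2) 0 = ?\<mu>"
    using expect_triangle_probe[OF uv(1) M assms(2)] by (simp_all add: uv(3))
  have rmu: "real k * (real ?r * ?\<mu>) = credit \<tau> a b" using r assms by simp
  show "ex (probe_edge \<tau> k a b) (\<lambda>z. z) 0 = credit \<tau> a b"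
    using expect_sum_of[OF fin, of ?r 0] rmu by (simp add: uv(5) expect_bind expect_mult0 mu)
  have "ex (sum_of ?r ?A) (\<lambda>s. s\<^sup>2) 0 = real ?r * (?\<mu> - ?\<mu>\<^sup>2) + (real ?r * ?\<mu>)\<^sup>2"
    using expect_sum_of_square[OF fin, of ?r 0] by (simp only: mu add_0_right)
  then have "ex (probe_edge \<tau> k a b) (\<lambda>z. z\<^sup>2) 0 =
      (real k)\<^sup>2 * (real ?r * (?\<mu> - ?\<mu>\<^sup>2) + (real ?r * ?\<mu>)\<^sup>2)"
    by (simp only: uv(5) expect_bind expect.simps power_mult_distrib expect_mult0
        mult_zero_right add_0_left)
  also have "\<dots> \<le> (real k)\<^sup>2 * (real ?r * ?\<mu> + (real ?r * ?\<mu>)\<^sup>2)"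
    by (intro mult_left_mono add_right_mono) auto
  also have "\<dots> = real k * (real k * (real ?r * ?\<mu>)) + (real k * (real ?r * ?\<mu>))\<^sup>2"
    by (simp add: algebra_simps power2_eq_square)
  finally show "ex (probe_edge \<tau> k a b) (\<lambda>z. z\<^sup>2) 0 \<le> real k * credit \<tau> a b + (credit \<tau> a b)\<^sup>2"
    by (simp only: rmu)
  have "cost (probe_edge \<tau> k a b) = 2 + real ?r * cost ?A"
    by (simp add: uv(5) cost_bind cost_sum_of[OF fin] ex_const finite_tosses_sum_of[OF fin])
  also have "real ?r * cost ?A \<le> real ?r * (2 + check_cost \<tau> a b / real (?r * k))"
    using cost_triangle_probe[OF uv(1) M assms(2)] by (intro mult_left_mono) (simp_all add: uv(4))
  also have "\<dots> = 2 * real ?r + check_cost \<tau> a b / real k"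
    using r assms by (simp add: field_simps)
  finally show "cost (probe_edge \<tau> k a b) \<le>
      4 + 2 * real (min_degree E a b) / real k + check_cost \<tau> a b / real k"
    using blocks_le[of "min_degree E a b" k] by simp
qed

section \<open>Mean, bias, second moment and expected cost of one round\<close>

lemma expect_sampling_round:
  assumes "F 0 = 0" "0 < \<tau>"
  shows "m * ex (sampling_round \<tau> k) F 0 =
    (\<Sum>e\<in>E. light_prob E \<tau> (Min e) (Max e) * ex (probe_edge \<tau> k (Min e) (Max e)) F 0)"
  using m_pos unfolding sampling_round_def
  by (simp add: expect_bind expect_edge_test[OF min_max_edge assms(2)] assms(1))

text \<open>For \<open>a < b < c\<close> the edges \<open>bc\<close>, \<open>ac\<close>,
  \<open>ab\<close> are credited in this order, with probabilities \<open>p\<close>,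
  \<open>(1 - p) * q\<close> and \<open>(1 - p) * (1 - q) * r\<close>, where \<open>p\<close>,
  \<open>q\<close>, \<open>r\<close> are their light probabilities. The sum telescopes to
  \<open>1 - (1 - p) * (1 - q) * (1 - r)\<close>.\<close>

lemma round_mean:
  assumes "0 < \<tau>" "0 < k"
  shows "m * ex (sampling_round \<tau> k) (\<lambda>z. z) 0 = tri - (\<Sum>(a, b, c)\<in>sorted_triads E.
    (1 - light_prob E \<tau> a b) * (1 - light_prob E \<tau> a c) * (1 - light_prob E \<tau> b c))"
proof -
  have "2 * (m * ex (sampling_round \<tau> k) (\<lambda>z. z) 0) =
      2 * (\<Sum>e\<in>E. light_prob E \<tau> (Min e) (Max e) * credit \<tau> (Min e) (Max e))"
    using probe_edge_moments(1)[OF min_max_edge assms] by (simp add: expect_sampling_round assms(1))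
  also have "\<dots> = (\<Sum>(a, b)\<in>arcs E. light_prob E \<tau> a b * credit \<tau> a b)"
    by (rule sum_edges) (simp only: light_prob_commute credit_commute)
  also have "\<dots> = (\<Sum>(a, b, c)\<in>triads E. light_prob E \<tau> a b * credit_prob E \<tau> a b c)"
    by (simp add: credit_def sum_distrib_left flip: sum_arcs_common)
  also have "\<dots> = (\<Sum>(a, b, c)\<in>sorted_triads E. 2 * (1 -
      (1 - light_prob E \<tau> a b) * (1 - light_prob E \<tau> a c) * (1 - light_prob E \<tau> b c)))"
    unfolding sum_triads_sorted
  proof (intro sum.cong refl, clarify)
    fix a b c assume "(a, b, c) \<in> sorted_triads E"
    then have "a < b" "b < c" "a < c" by (auto simp: sorted_triads_def)
    then show "light_prob E \<tau> a b * credit_prob E \<tau> a b c + light_prob E \<tau> a c * credit_prob E \<tau> a c b +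
        light_prob E \<tau> b a * credit_prob E \<tau> b a c + light_prob E \<tau> b c * credit_prob E \<tau> b c a +
        light_prob E \<tau> c a * credit_prob E \<tau> c a b + light_prob E \<tau> c b * credit_prob E \<tau> c b a =
      2 * (1 - (1 - light_prob E \<tau> a b) * (1 - light_prob E \<tau> a c) * (1 - light_prob E \<tau> b c))"
      by (simp add: credit_prob_def light_prob_commute[of E \<tau> b a] light_prob_commute[of E \<tau> c a]
          light_prob_commute[of E \<tau> c b] algebra_simps)
  qed
  also have "\<dots> = 2 * (tri - (\<Sum>(a, b, c)\<in>sorted_triads E.
      (1 - light_prob E \<tau> a b) * (1 - light_prob E \<tau> a c) * (1 - light_prob E \<tau> b c)))"
    by (simp add: sum_subtractf case_prod_unfold flip: sum_distrib_left)
  finally show ?thesis by simp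
qed

text \<open>The product is at most each of its factors, so \<open>sum_sorted_triads_le\<close>
  charges a lost triangle to a single edge. Then \<open>heavy_prob_le\<close> applies, and the
  triangle counts of all arcs sum to \<open>6 * tri\<close>.\<close>

lemma round_bias:
  assumes "0 < \<tau>"
  defines "bias \<equiv> (\<Sum>(a, b, c)\<in>sorted_triads E.
    (1 - light_prob E \<tau> a b) * (1 - light_prob E \<tau> a c) * (1 - light_prob E \<tau> b c))"
  shows "0 \<le> bias" "bias \<le> 6 * real \<alpha> * tri / real \<tau>"
proof -
  have edges: "{a, b} \<in> E \<and> {a, c} \<in> E \<and> {b, c} \<in> E" if "(a, b, c) \<in> sorted_triads E" for a b c
    using that by (auto simp: sorted_triads_def triads_def)
  show "0 \<le> bias"
    unfolding bias_def using light_prob_bounds assms(1) edges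
    by (intro sum_nonneg) (fastforce intro!: mult_nonneg_nonneg)
  have "bias \<le> real \<alpha> * (\<Sum>(a, b)\<in>arcs E. 1 - light_prob E \<tau> a b)"
    unfolding bias_def
  proof (rule sum_sorted_triads_le)
    fix a b c assume "(a, b, c) \<in> sorted_triads E"
    then have e: "{a, b} \<in> E" "{a, c} \<in> E" "{b, c} \<in> E" using edges by auto
    define p q r where pqr: "p = 1 - light_prob E \<tau> a b" "q = 1 - light_prob E \<tau> a c"
      "r = 1 - light_prob E \<tau> b c"
    have b: "0 \<le> p" "p \<le> 1" "0 \<le> q" "q \<le> 1" "0 \<le> r" "r \<le> 1"
      using e[THEN light_prob_bounds(1), OF assms(1)] e[THEN light_prob_bounds(2), OF assms(1)]
      by (auto simp: pqr)
    have pq: "p * q \<le> p" "p * q \<le> q" "0 \<le> p * q"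
      using b by (auto intro: mult_left_le mult_left_le_one_le)
    then have "p * q * r \<le> p * q" "p * q * r \<le> r"
      using b mult_left_le[of r "p * q"] mult_left_le_one_le[of r "p * q"] by auto
    then show "(1 - light_prob E \<tau> a b) * (1 - light_prob E \<tau> a c) * (1 - light_prob E \<tau> b c)
          \<le> 1 - light_prob E \<tau> a b \<and>
        (1 - light_prob E \<tau> a b) * (1 - light_prob E \<tau> a c) * (1 - light_prob E \<tau> b c)
          \<le> 1 - light_prob E \<tau> a c \<and>
        (1 - light_prob E \<tau> a b) * (1 - light_prob E \<tau> a c) * (1 - light_prob E \<tau> b c)
          \<le> 1 - light_prob E \<tau> b c"
      using pq unfolding pqr[symmetric] by linarith
  qed (use light_prob_bounds assms(1) light_prob_commute in auto)
  also have "\<dots> \<le> real \<alpha> * (\<Sum>(a, b)\<in>arcs E. real (card (common E a b)) / real \<tau>)"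
    using heavy_prob_le assms(1) by (intro mult_left_mono sum_mono) (auto simp: arcs_def)
  also have "(\<Sum>(a, b)\<in>arcs E. real (card (common E a b)) / real \<tau>) = 6 * tri / real \<tau>"
    by (simp add: case_prod_unfold sum_card_common[unfolded case_prod_unfold] flip: sum_divide_distrib)
  finally show "bias \<le> 6 * real \<alpha> * tri / real \<tau>" by (simp add: mult_ac)
qed

text \<open>An edge contributes at most \<open>p * (k * t + t\<^sup>2)\<close>, where
  \<open>p * t \<le> \<tau>\<close> removes the square; over the edges, \<open>t\<close> sums to
  \<open>3 * tri\<close>.\<close>

lemma round_second_moment:
  assumes "0 < \<tau>" "0 < k"
  shows "m * ex (sampling_round \<tau> k) (\<lambda>z. z\<^sup>2) 0 \<le> 3 * (real k + real \<tau>) * tri"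
proof -
  let ?t = "\<lambda>a b. real (card (common E a b))"
  have "2 * (m * ex (sampling_round \<tau> k) (\<lambda>z. z\<^sup>2) 0) =
      2 * (\<Sum>e\<in>E. light_prob E \<tau> (Min e) (Max e) * ex (probe_edge \<tau> k (Min e) (Max e)) (\<lambda>z. z\<^sup>2) 0)"
    by (simp add: expect_sampling_round assms(1))
  also have "\<dots> \<le> 2 * (\<Sum>e\<in>E. (real k + real \<tau>) * ?t (Min e) (Max e))"
  proof (intro mult_left_mono sum_mono)
    fix e assume "e \<in> E"
    then have e: "{Min e, Max e} \<in> E" by (rule min_max_edge)
    define p x t where pxt: "p = light_prob E \<tau> (Min e) (Max e)" "x = credit \<tau> (Min e) (Max e)"
      "t = ?t (Min e) (Max e)"
    have x: "0 \<le> x" "x \<le> t" and p: "0 \<le> p" "p \<le> 1" "p * t \<le> real \<tau>"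
      using credit_bounds[OF e assms(1)] light_prob_bounds[OF e assms(1)]
        light_prob_mult_le[OF e assms(1)] by (auto simp: pxt)
    have "p * ex (probe_edge \<tau> k (Min e) (Max e)) (\<lambda>z. z\<^sup>2) 0 \<le> p * (real k * x + x\<^sup>2)"
      using p probe_edge_moments(2)[OF e assms] by (intro mult_left_mono) (auto simp: pxt)
    also have "\<dots> \<le> p * (real k * t + t\<^sup>2)"
      using p x by (intro mult_left_mono add_mono power_mono) auto
    also have "\<dots> = p * (real k * t) + p * t * t" by (simp add: algebra_simps power2_eq_square)
    also have "\<dots> \<le> 1 * (real k * t) + real \<tau> * t"
      using p x by (intro add_mono mult_right_mono) auto
    finally show "light_prob E \<tau> (Min e) (Max e) * ex (probe_edge \<tau> k (Min e) (Max e)) (\<lambda>z. z\<^sup>2) 0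
        \<le> (real k + real \<tau>) * ?t (Min e) (Max e)"
      by (simp add: pxt algebra_simps)
  qed simp
  also have "\<dots> = (\<Sum>(a, b)\<in>arcs E. (real k + real \<tau>) * ?t a b)"
    by (rule sum_edges) (simp only: common_commute)
  also have "\<dots> = (real k + real \<tau>) * (6 * tri)"
    by (simp add: case_prod_unfold sum_card_common[unfolded case_prod_unfold] flip: sum_distrib_left)
  finally show ?thesis by (simp add: algebra_simps)
qed

text \<open>Permuting triads makes the tested edge the leading arc, so a test is weighted by the
  number of triangles on its edge and \<open>cost_edge_test(2)\<close> applies. The constant is
  \<open>2 * (48 + 16)\<close>.\<close>

lemma sum_check_cost:
  assumes "0 < \<tau>"
  shows "(\<Sum>(a, b)\<in>arcs E. check_cost \<tau> a b) \<le> 128 * real \<alpha> * m"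
proof -
  let ?C = "\<lambda>a b. cost (edge_test \<tau> a b)"
  have "(\<Sum>(a, b)\<in>arcs E. check_cost \<tau> a b) = (\<Sum>(a, b, c)\<in>triads E. ?C b c + ?C a c)"
    by (simp add: check_cost_def flip: sum_arcs_common)
  also have "\<dots> = (\<Sum>(a, b, c)\<in>triads E. ?C b c) + (\<Sum>(a, b, c)\<in>triads E. ?C a c)"
    by (simp add: sum.distrib case_prod_unfold)
  also have "(\<Sum>(a, b, c)\<in>triads E. ?C a c) = (\<Sum>(a, b, c)\<in>triads E. ?C b c)"
    using sum_triads_swap[of "\<lambda>a b c. ?C b c"] .
  also have "(\<Sum>(a, b, c)\<in>triads E. ?C b c) = (\<Sum>(a, b, c)\<in>triads E. ?C a b)"
    using sum_triads_rotate[of "\<lambda>a b c. ?C a b"] .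
  also have "\<dots> = (\<Sum>(a, b)\<in>arcs E. real (card (common E a b)) * ?C a b)"
    by (simp flip: sum_arcs_common)
  also have "\<dots> \<le> (\<Sum>(a, b)\<in>arcs E. 4 * real (card (common E a b)) + 4 * real (min_degree E a b))"
    using cost_edge_test(2) assms by (intro sum_mono) (auto simp: arcs_def)
  also have "\<dots> = 24 * tri + 4 * (\<Sum>(a, b)\<in>arcs E. real (min_degree E a b))"
    by (simp add: sum.distrib case_prod_unfold sum_card_common[unfolded case_prod_unfold]
        flip: sum_distrib_left)
  also have "\<dots> \<le> 64 * real \<alpha> * m"
    using triangles_le sum_min_degree by simp
  finally show ?thesis by simp
qed

text \<open>One query for the random edge, and on average over the edges at most
  \<open>(16 + 16 + 128) / 2 = 80\<close> for fixed costs, probes and checks.\<close>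

lemma cost_sampling_round:
  assumes "0 < \<alpha>" "\<alpha> \<le> \<tau>"
  shows "cost (sampling_round \<tau> \<alpha>) \<le> 81"
proof -
  have \<tau>: "0 < \<tau>" using assms by simp
  let ?d = "\<lambda>a b. real (min_degree E a b)"
  let ?B = "\<lambda>a b. 8 + (4 / real \<alpha>) * ?d a b + check_cost \<tau> a b / real \<alpha>"
  have "cost (sampling_round \<tau> \<alpha>) = 1 + (\<Sum>e\<in>E. cost (edge_test \<tau> (Min e) (Max e)) +
      light_prob E \<tau> (Min e) (Max e) * cost (probe_edge \<tau> \<alpha> (Min e) (Max e))) / m"
    unfolding sampling_round_def
    by (simp add: cost_bind expect_edge_test[OF min_max_edge \<tau>])
  also have "\<dots> \<le> 1 + (\<Sum>e\<in>E. ?B (Min e) (Max e)) / m"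
  proof (intro add_left_mono divide_right_mono sum_mono)
    fix e assume "e \<in> E"
    then have e: "{Min e, Max e} \<in> E" by (rule min_max_edge)
    have "light_prob E \<tau> (Min e) (Max e) * cost (probe_edge \<tau> \<alpha> (Min e) (Max e)) \<le>
        1 * cost (probe_edge \<tau> \<alpha> (Min e) (Max e))"
      using light_prob_bounds[OF e \<tau>] cost_nonneg by (intro mult_right_mono) auto
    moreover have "?d (Min e) (Max e) / real \<tau> \<le> ?d (Min e) (Max e) / real \<alpha>"
      using assms by (intro divide_left_mono) auto
    ultimately show "cost (edge_test \<tau> (Min e) (Max e)) +
        light_prob E \<tau> (Min e) (Max e) * cost (probe_edge \<tau> \<alpha> (Min e) (Max e)) \<le> ?B (Min e) (Max e)"
      using cost_edge_test(1)[OF e \<tau>] probe_edge_moments(3)[OF e \<tau> assms(1)] by simp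
  qed simp
  also have "\<dots> \<le> 1 + 80"
  proof -
    have "2 * (\<Sum>e\<in>E. ?B (Min e) (Max e)) = (\<Sum>(a, b)\<in>arcs E. ?B a b)"
      by (rule sum_edges) (simp only: min_degree_commute check_cost_commute)
    also have "\<dots> = 16 * m + (4 / real \<alpha>) * (\<Sum>(a, b)\<in>arcs E. ?d a b) +
        (\<Sum>(a, b)\<in>arcs E. check_cost \<tau> a b) / real \<alpha>"
      by (simp add: sum.distrib case_prod_unfold sum_distrib_left sum_divide_distrib card_arcs)
    also have "\<dots> \<le> 16 * m + (4 / real \<alpha>) * (4 * real \<alpha> * m) + (128 * real \<alpha> * m) / real \<alpha>"
      using sum_min_degree sum_check_cost[OF \<tau>]
      by (intro add_mono mult_left_mono divide_right_mono) auto
    also have "\<dots> = 160 * m" using assms by simp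
    finally have "(\<Sum>e\<in>E. ?B (Min e) (Max e)) \<le> 80 * m" by simp
    then show ?thesis using m_pos by (simp add: pos_divide_le_eq)
  qed
  finally show ?thesis by simp
qed

end

section \<open>Search for the number of triangles\<close>

definition estimate :: "nat \<Rightarrow> nat \<Rightarrow> nat \<Rightarrow> nat \<Rightarrow> algorithm" where
  "estimate m \<tau> \<alpha> N =
     bind_alg (sum_of N (sampling_round \<tau> \<alpha>)) (\<lambda>s. Output (real m / real N * s))"

text \<open>The constant 200000 keeps \<open>48 * 128 / 200000 + 4 / 128\<close>, the failure bound
  of the whole search, just below \<open>1 / 16\<close>.\<close>

definition num_rounds :: "nat \<Rightarrow> nat \<Rightarrow> real \<Rightarrow> real \<Rightarrow> nat" where
  "num_rounds m \<tau> \<eta> g = nat \<lceil>200000 * real m * real \<tau> / (\<eta>\<^sup>2 * g)\<rceil>"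

text \<open>The depth bound makes the tree well-founded. The default 0 is the correct answer for a
  graph without triangles.\<close>

primrec search :: "nat \<Rightarrow> nat \<Rightarrow> nat \<Rightarrow> real \<Rightarrow> nat \<Rightarrow> real \<Rightarrow> algorithm" where
  "search m \<tau> \<alpha> \<eta> 0 g = Output 0"
| "search m \<tau> \<alpha> \<eta> (Suc k) g =
     bind_alg (estimate m \<tau> \<alpha> (num_rounds m \<tau> \<eta> g))
       (\<lambda>y. if g \<le> y then Output y else search m \<tau> \<alpha> \<eta> k (g / 2))"

definition median :: "real list \<Rightarrow> real" where
  "median xs = sort xs ! (length xs div 2)"

primrec median_of_runs :: "nat \<Rightarrow> algorithm \<Rightarrow> real list \<Rightarrow> algorithm" where
  "median_of_runs 0 A xs = Output (median xs)"
| "median_of_runs (Suc k) A xs = bind_alg A (\<lambda>x. median_of_runs k A (x # xs))"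

definition coin :: "real \<Rightarrow> nat pmf" where
  "coin p = map_pmf of_bool (bernoulli_pmf p)"

text \<open>The coin is needed for \<open>\<delta>\<close> close to 1, where the query bound \<open>O(ln (1 / \<delta>))\<close> tends to 0 and
  even a single run is too expensive.\<close>

definition triangle_counter :: "nat \<Rightarrow> nat \<Rightarrow> real \<Rightarrow> real \<Rightarrow> algorithm" where
  "triangle_counter m \<alpha> \<epsilon> \<delta> =
     (if m = 0 then Output 0
      else Toss (coin (min 1 (2 * (1 - \<delta>)))) (\<lambda>b. if b = 0 then Output 0 else
        median_of_runs (nat \<lceil>log 2 (1 / \<delta>)\<rceil>)
          (search m (nat \<lceil>24 * real \<alpha> / \<epsilon>\<rceil>) \<alpha> (\<epsilon> / 2) (8 * m * \<alpha>) (2 * real m * real \<alpha>)) []))"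

lemma finite_tosses_estimate: "0 < \<tau> \<Longrightarrow> 0 < \<alpha> \<Longrightarrow> finite_tosses (estimate m \<tau> \<alpha> N)"
  by (simp add: estimate_def finite_tosses_bind finite_tosses_sum_of finite_tosses_sampling_round)

lemma finite_tosses_search: "0 < \<tau> \<Longrightarrow> 0 < \<alpha> \<Longrightarrow> finite_tosses (search m \<tau> \<alpha> \<eta> k g)"
  by (induction k arbitrary: g) (simp_all add: finite_tosses_bind finite_tosses_estimate)

lemma finite_tosses_median_of_runs: "finite_tosses A \<Longrightarrow> finite_tosses (median_of_runs k A xs)"
  by (induction k arbitrary: xs) (simp_all add: finite_tosses_bind)

text \<open>If the middle of the sorted list lies outside, so do all entries on one side of it, the
  middle included; either side holds at least half of the list.\<close>

lemma median_outside:
  assumes "xs \<noteq> []" "median xs \<notin> {lo..hi}"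
  shows "length xs \<le> 2 * length (filter (\<lambda>x. x \<notin> {lo..hi}) xs)"
proof -
  let ?ys = "sort xs" and ?n = "length xs" and ?P = "\<lambda>x. x \<notin> {lo..hi}"
  let ?h = "?n div 2"
  have h: "?h < ?n" using assms(1) by (simp add: div_less_dividend)
  have mono: "?ys ! i \<le> ?ys ! j" if "i \<le> j" "j < ?n" for i j
    using that by (intro sorted_nth_mono) auto
  have "length (filter ?P xs) = size (filter_mset ?P (mset xs))" by (metis mset_filter size_mset)
  also have "\<dots> = length (filter ?P ?ys)" by (metis mset_filter mset_sort size_mset)
  also have "\<dots> = card {i. i < ?n \<and> ?P (?ys ! i)}" by (simp add: length_filter_conv_card)
  finally have len: "length (filter ?P xs) = card {i. i < ?n \<and> ?P (?ys ! i)}" .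
  have "?ys ! ?h < lo \<or> hi < ?ys ! ?h" using assms(2) by (auto simp: median_def)
  then show ?thesis
  proof
    assume lo: "?ys ! ?h < lo"
    have "{..?h} \<subseteq> {i. i < ?n \<and> ?P (?ys ! i)}"
    proof clarify
      fix i assume "i \<le> ?h"
      then show "i < ?n \<and> ?P (?ys ! i)" using mono[of i ?h] lo h by auto
    qed
    from card_mono[OF _ this] len show ?thesis by simp
  next
    assume hi: "hi < ?ys ! ?h"
    have "{?h..<?n} \<subseteq> {i. i < ?n \<and> ?P (?ys ! i)}"
    proof clarify
      fix i assume "i \<in> {?h..<?n}"
      then show "i < ?n \<and> ?P (?ys ! i)" using mono[of ?h i] hi by auto
    qed
    from card_mono[OF _ this] len show ?thesis by simp
  qed
qed

lemma pmf_coin: "0 \<le> p \<Longrightarrow> p \<le> 1 \<Longrightarrow> pmf (coin p) 1 = p \<and> pmf (coin p) 0 = 1 - p"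
  using pmf_map_inj'[of "of_bool :: bool \<Rightarrow> nat" "bernoulli_pmf p" True]
    pmf_map_inj'[of "of_bool :: bool \<Rightarrow> nat" "bernoulli_pmf p" False]
  by (simp add: coin_def inj_def)

lemma set_pmf_coin: "set_pmf (coin p) \<subseteq> {0, 1}"
  by (auto simp: coin_def)

lemma sum_coin:
  assumes "0 \<le> p" "p \<le> 1"
  shows "(\<Sum>r\<in>set_pmf (coin p). pmf (coin p) r * h r) = p * h 1 + (1 - p) * h 0"
proof -
  have "(\<Sum>r\<in>set_pmf (coin p). pmf (coin p) r * h r) = (\<Sum>r\<in>{0, 1}. pmf (coin p) r * h r)"
    using set_pmf_coin by (intro sum.mono_neutral_left) (auto simp: set_pmf_iff)
  then show ?thesis using pmf_coin[OF assms] by simp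
qed

section \<open>Failure probability and expected cost of the halving search\<close>

context query_model
begin

text \<open>Markov's inequality for the square. It is used with \<open>c\<close> the mean
  (Chebyshev) and with \<open>c = 0\<close>.\<close>

lemma indicator_le_square:
  assumes "0 < a" "\<And>y. y \<in> S \<Longrightarrow> a \<le> \<bar>y - c\<bar>"
  shows "ex A (indicat_real S) 0 \<le> ex A (\<lambda>y. (y - c)\<^sup>2) 0 / a\<^sup>2"
proof -
  have "ex A (indicat_real S) 0 \<le> ex A (\<lambda>y. (1 / a\<^sup>2) * (y - c)\<^sup>2) 0"
  proof (rule expect_mono)
    fix y
    show "indicat_real S y \<le> (1 / a\<^sup>2) * (y - c)\<^sup>2"
    proof (cases "y \<in> S")
      case True
      then have "a\<^sup>2 \<le> (y - c)\<^sup>2" using assms power_mono[of a "\<bar>y - c\<bar>" 2] by simp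
      then show ?thesis using True assms by simp
    qed simp
  qed
  then show ?thesis by (simp only: expect_mult0) simp
qed

lemma ex_le_1: "finite_tosses A \<Longrightarrow> (\<And>x. F x \<le> 1) \<Longrightarrow> ex A F 0 \<le> 1"
  using expect_mono[of F "\<lambda>_. 1" E nb A 0] ex_const[of A 1] by simp

context
  fixes \<tau> :: nat and \<eta> :: real
  assumes \<alpha>: "0 < \<alpha>" and \<eta>: "0 < \<eta>" "\<eta> < 1 / 2" and \<tau>: "12 * real \<alpha> / \<eta> \<le> real \<tau>"
begin

lemma tau_ge: "24 * real \<alpha> \<le> real \<tau>"
proof -
  have "24 * real \<alpha> \<le> 12 * real \<alpha> / \<eta>" using \<alpha> \<eta> by (simp add: field_simps)
  then show ?thesis using \<tau> by simp
qed

lemma tau_pos: "0 < \<tau>" and alpha_le_tau: "\<alpha> \<le> \<tau>"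
  using tau_ge \<alpha> by linarith+

abbreviation "mean \<equiv> m * ex (sampling_round \<tau> \<alpha>) (\<lambda>z. z) 0"

text \<open>\<open>\<tau> \<ge> 12 * \<alpha> / \<eta>\<close> limits the relative bias
  \<open>6 * \<alpha> / \<tau>\<close> to \<open>\<eta> / 2\<close>; the other half of the tolerance
  is left to random deviation.\<close>

lemma mean_bounds: "(1 - \<eta> / 2) * tri \<le> mean" "mean \<le> tri"
proof -
  note b = round_bias[OF tau_pos] round_mean[OF tau_pos \<alpha>]
  have "12 * real \<alpha> * tri \<le> (real \<tau> * \<eta>) * tri"
    using \<tau> \<eta> by (intro mult_right_mono) (simp_all add: field_simps)
  then have "6 * real \<alpha> * tri / real \<tau> \<le> \<eta> / 2 * tri"
    using tau_pos by (simp add: field_simps)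
  then have "mean \<ge> tri - \<eta> / 2 * tri" using b by linarith
  then show "(1 - \<eta> / 2) * tri \<le> mean" by (simp add: algebra_simps)
  show "mean \<le> tri" using b by linarith
qed

lemma estimate_variance:
  assumes "0 < N"
  shows "ex (estimate (card E) \<tau> \<alpha> N) (\<lambda>y. (y - mean)\<^sup>2) 0 \<le> 6 * m * real \<tau> * tri / real N"
    and "ex (estimate (card E) \<tau> \<alpha> N) (\<lambda>y. y\<^sup>2) 0 \<le> 6 * m * real \<tau> * tri / real N + tri\<^sup>2"
proof -
  let ?A = "sampling_round \<tau> \<alpha>"
  define \<mu> v where mv: "\<mu> = ex ?A (\<lambda>z. z) 0" "v = ex ?A (\<lambda>z. z\<^sup>2) 0"
  note S = expect_sum_of_square[OF finite_tosses_sampling_round[OF tau_pos \<alpha>], of N, folded mv]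
  have mean: "mean = m * \<mu>" by (simp add: mv)
  have "m * v \<le> 3 * (real \<alpha> + real \<tau>) * tri"
    using round_second_moment[OF tau_pos \<alpha>] by (simp add: mv)
  also have "\<dots> \<le> 6 * real \<tau> * tri" using alpha_le_tau by (intro mult_right_mono) auto
  finally have v: "m * v \<le> 6 * real \<tau> * tri" .
  have "(m / real N)\<^sup>2 * (real N * (v - \<mu>\<^sup>2)) \<le> (m / real N)\<^sup>2 * (real N * v)"
    by (intro mult_left_mono) auto
  also have "\<dots> = m * (m * v) / real N" using assms by (simp add: field_simps power2_eq_square)
  also have "\<dots> \<le> m * (6 * real \<tau> * tri) / real N"
    using v by (intro divide_right_mono mult_left_mono) auto
  finally have var: "(m / real N)\<^sup>2 * (real N * (v - \<mu>\<^sup>2)) \<le> 6 * m * real \<tau> * tri / real N"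
    by (simp add: mult_ac)
  have "(m / real N * s - mean)\<^sup>2 = (m / real N)\<^sup>2 * (s + - (real N * \<mu>))\<^sup>2" for s
  proof -
    have "m / real N * s - mean = m / real N * (s + - (real N * \<mu>))"
      using assms unfolding mean by (simp add: field_simps)
    then show ?thesis by (simp only: power_mult_distrib)
  qed
  then have "ex (estimate (card E) \<tau> \<alpha> N) (\<lambda>y. (y - mean)\<^sup>2) 0 =
      (m / real N)\<^sup>2 * (real N * (v - \<mu>\<^sup>2) + (real N * \<mu> + - (real N * \<mu>))\<^sup>2)"
    by (simp only: estimate_def expect_bind expect.simps expect_mult0 S)
  then show "ex (estimate (card E) \<tau> \<alpha> N) (\<lambda>y. (y - mean)\<^sup>2) 0 \<le> 6 * m * real \<tau> * tri / real N"
    using var by simp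
  have "0 \<le> (1 - \<eta> / 2) * tri" using \<eta> by simp
  then have "0 \<le> mean" using mean_bounds(1) by linarith
  then have "mean\<^sup>2 \<le> tri\<^sup>2" using mean_bounds(2) by (intro power_mono)
  moreover have "ex (estimate (card E) \<tau> \<alpha> N) (\<lambda>y. y\<^sup>2) 0 =
      (m / real N)\<^sup>2 * (real N * (v - \<mu>\<^sup>2) + (real N * \<mu>)\<^sup>2)"
    using S[of 0]
    by (simp only: estimate_def expect_bind expect.simps power_mult_distrib expect_mult0 add_0_right)
  moreover have "(m / real N)\<^sup>2 * (real N * \<mu>)\<^sup>2 = mean\<^sup>2"
    using assms unfolding mean by (simp add: field_simps power2_eq_square)
  ultimately show "ex (estimate (card E) \<tau> \<alpha> N) (\<lambda>y. y\<^sup>2) 0 \<le> 6 * m * real \<tau> * tri / real N + tri\<^sup>2"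
    using var by (simp add: distrib_left)
qed

abbreviation "good \<equiv> {(1 - \<eta>) * tri..(1 + \<eta>) * tri}"
abbreviation "est g \<equiv> estimate (card E) \<tau> \<alpha> (num_rounds (card E) \<tau> \<eta> g)"
abbreviation "sea k g \<equiv> search (card E) \<tau> \<alpha> \<eta> k g"

lemma finite_tosses_est: "finite_tosses (est g)"
  by (rule finite_tosses_estimate[OF tau_pos \<alpha>])

lemma finite_tosses_sea: "finite_tosses (sea k g)"
  by (rule finite_tosses_search[OF tau_pos \<alpha>])

lemma num_rounds_ge:
  assumes "0 < g"
  shows "0 < num_rounds (card E) \<tau> \<eta> g"
    and "200000 * m * real \<tau> / (\<eta>\<^sup>2 * g) \<le> real (num_rounds (card E) \<tau> \<eta> g)"
    and "6 * m * real \<tau> * tri / real (num_rounds (card E) \<tau> \<eta> g) \<le> 6 * \<eta>\<^sup>2 * g * tri / 200000"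
proof -
  let ?N = "num_rounds (card E) \<tau> \<eta> g"
  let ?x = "200000 * m * real \<tau> / (\<eta>\<^sup>2 * g)"
  have x: "0 < ?x" using m_pos tau_pos \<eta> assms by simp
  show ge: "?x \<le> real ?N"
    unfolding num_rounds_def by (rule real_nat_ceiling_ge)
  then show N: "0 < ?N" using x by (cases ?N) auto
  have "6 * m * real \<tau> * tri / real ?N \<le> 6 * m * real \<tau> * tri / ?x"
    using ge N by (intro divide_left_mono mult_pos_pos x) auto
  also have "\<dots> = 6 * \<eta>\<^sup>2 * g * tri / 200000"
    using m_pos tau_pos \<eta> assms by (simp add: field_simps)
  finally show "6 * m * real \<tau> * tri / real ?N \<le> 6 * \<eta>\<^sup>2 * g * tri / 200000" .
qed

text \<open>Chebyshev with deviation \<open>\<eta> * tri / 2\<close>. The number of rounds is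
  proportional to \<open>1 / g\<close>, so this is informative only while \<open>g\<close> is not
  far above \<open>tri\<close>.\<close>

lemma est_inaccurate:
  assumes "0 < g" "0 < tri"
  shows "ex (est g) (indicat_real (- good)) 0 \<le> 24 * g / (200000 * tri)"
proof -
  have "ex (est g) (indicat_real (- good)) 0 \<le>
      ex (est g) (\<lambda>y. (y - mean)\<^sup>2) 0 / (\<eta> * tri / 2)\<^sup>2"
  proof (rule indicator_le_square)
    fix y assume "y \<in> - good"
    then have "y < tri - \<eta> * tri \<or> tri + \<eta> * tri < y" by (auto simp: algebra_simps)
    moreover have "tri - \<eta> * tri / 2 \<le> mean" "mean \<le> tri"
      using mean_bounds by (simp_all add: algebra_simps)
    moreover have "0 < \<eta> * tri" using \<eta> assms by simp
    ultimately show "\<eta> * tri / 2 \<le> \<bar>y - mean\<bar>" by linarith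
  qed (use \<eta> assms in simp)
  also have "\<dots> \<le> (6 * \<eta>\<^sup>2 * g * tri / 200000) / (\<eta> * tri / 2)\<^sup>2"
    using estimate_variance(1)[OF num_rounds_ge(1)[OF assms(1)]] num_rounds_ge(3)[OF assms(1)]
    by (intro divide_right_mono) auto
  also have "\<dots> = 24 * g / (200000 * tri)"
    using \<eta> assms by (simp add: field_simps power2_eq_square)
  finally show ?thesis .
qed

text \<open>For guesses far above \<open>tri\<close> accuracy is out of reach, but Markov still
  makes a premature acceptance unlikely.\<close>

lemma est_large:
  assumes "0 < g"
  shows "ex (est g) (indicat_real {g..}) 0 \<le> (g * tri + tri\<^sup>2) / g\<^sup>2"
proof -
  have "ex (est g) (indicat_real {g..}) 0 \<le> ex (est g) (\<lambda>y. (y - 0)\<^sup>2) 0 / g\<^sup>2"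
    using assms by (intro indicator_le_square) auto
  also have "\<dots> \<le> (6 * \<eta>\<^sup>2 * g * tri / 200000 + tri\<^sup>2) / g\<^sup>2"
    using estimate_variance(2)[OF num_rounds_ge(1)[OF assms(1)]] num_rounds_ge(3)[OF assms(1)]
    by (intro divide_right_mono) auto
  also have "\<dots> \<le> (g * tri + tri\<^sup>2) / g\<^sup>2"
  proof -
    have "\<eta>\<^sup>2 \<le> 1" using \<eta> by (simp add: power_le_one)
    then have "(6 * \<eta>\<^sup>2 / 200000) * (g * tri) \<le> 1 * (g * tri)"
      using assms by (intro mult_right_mono) auto
    then show ?thesis by (intro divide_right_mono add_right_mono) (simp_all add: mult_ac)
  qed
  finally show ?thesis .
qed

text \<open>\<open>g \<le> m * \<tau>\<close> makes the number of rounds at least 1 before rounding,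
  so rounding up at most doubles it; 162 is twice the 81 of a round.\<close>

lemma cost_est:
  assumes "0 < g" "g \<le> m * real \<tau>"
  shows "cost (est g) \<le> 162 * (200000 * m * real \<tau> / \<eta>\<^sup>2) / g"
proof -
  let ?N = "num_rounds (card E) \<tau> \<eta> g"
  define x where "x = 200000 * m * real \<tau> / (\<eta>\<^sup>2 * g)"
  have "\<eta>\<^sup>2 \<le> 1" using \<eta> by (simp add: power_le_one)
  then have "\<eta>\<^sup>2 * g \<le> 1 * (m * real \<tau>)" using assms by (intro mult_mono) auto
  then have "1 \<le> x" using \<eta> assms m_pos tau_pos by (simp add: x_def field_simps)
  have "real ?N \<le> x + 1"
    using real_nat_ceiling_le[of x] \<open>1 \<le> x\<close> by (simp add: num_rounds_def x_def)
  then have N: "real ?N \<le> 2 * x" using \<open>1 \<le> x\<close> by linarith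
  have "cost (est g) = real ?N * cost (sampling_round \<tau> \<alpha>)"
    by (simp add: estimate_def cost_bind cost_sum_of finite_tosses_sampling_round tau_pos \<alpha>
        ex_const finite_tosses_sum_of)
  also have "\<dots> \<le> (2 * x) * 81"
    using N cost_sampling_round[OF \<alpha> alpha_le_tau] cost_nonneg by (intro mult_mono) auto
  also have "\<dots> = 162 * (200000 * m * real \<tau> / \<eta>\<^sup>2) / g" by (simp add: x_def)
  finally show ?thesis .
qed

text \<open>One bound per regime: guesses near \<open>tri\<close> (\<open>?A\<close>), guesses far
  above it (\<open>?B\<close>), and guesses up to \<open>tri / 2\<close>, where
  \<open>\<eta> < 1 / 2\<close> makes every accurate estimate reach \<open>g\<close>, so that it
  ends the search with success.\<close>

lemma search_fail_Suc:
  "ex (sea (Suc k) g) (indicat_real (- good)) 0 \<le>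
     ex (est g) (indicat_real (- good)) 0 + ex (sea k (g / 2)) (indicat_real (- good)) 0" (is ?A)
  "ex (sea (Suc k) g) (indicat_real (- good)) 0 \<le>
     ex (est g) (indicat_real {g..}) 0 + ex (sea k (g / 2)) (indicat_real (- good)) 0" (is ?B)
  "0 < tri \<Longrightarrow> g \<le> tri / 2 \<Longrightarrow> ex (sea (Suc k) g) (indicat_real (- good)) 0 \<le>
     ex (est g) (indicat_real (- good)) 0"
proof -
  let ?f = "ex (sea k (g / 2)) (indicat_real (- good)) 0"
  have f: "0 \<le> ?f" "?f \<le> 1"
    using finite_tosses_sea by (auto intro!: expect_nonneg ex_le_1 simp: indicator_def)
  have eq: "ex (sea (Suc k) g) (indicat_real (- good)) 0 =
      ex (est g) (\<lambda>y. if g \<le> y then indicat_real (- good) y else ?f) 0"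
    by (simp add: expect_bind if_distrib[of "\<lambda>A. ex A _ _"] cong: if_cong)
  have "ex (sea (Suc k) g) (indicat_real (- good)) 0 \<le>
      ex (est g) (\<lambda>y. indicat_real (- good) y + ?f) 0"
    unfolding eq using f by (intro expect_mono) (auto simp: indicator_def)
  then show ?A by (simp only: expect_add0 ex_const finite_tosses_est)
  have "ex (sea (Suc k) g) (indicat_real (- good)) 0 \<le>
      ex (est g) (\<lambda>y. indicat_real {g..} y + ?f) 0"
    unfolding eq using f by (intro expect_mono) (auto simp: indicator_def)
  then show ?B by (simp only: expect_add0 ex_const finite_tosses_est)
  assume T: "0 < tri" "g \<le> tri / 2"
  have "g < (1 - \<eta>) * tri"
  proof -
    have "\<eta> * tri < 1 / 2 * tri" using \<eta> T by (intro mult_strict_right_mono)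
    moreover have "(1 - \<eta>) * tri = tri - \<eta> * tri" by (simp add: algebra_simps)
    ultimately show ?thesis using T by linarith
  qed
  then show "ex (sea (Suc k) g) (indicat_real (- good)) 0 \<le> ex (est g) (indicat_real (- good)) 0"
    unfolding eq using f by (intro expect_mono) (auto simp: indicator_def)
qed

text \<open>The failure probability as a function of \<open>x = g / tri\<close>: the sum over all later guesses of
  \<open>2 / x\<close> (guess far above the number of triangles accepted) and of \<open>24 x / 200000\<close> (inaccurate
  estimate for a guess below \<open>128 tri\<close>).\<close>

lemma search_fail:
  assumes "0 < tri" "0 < g" "0 < k" "4 * g \<le> tri * 2 ^ k"
  shows "ex (sea k g) (indicat_real (- good)) 0 \<le>
    (if g / tri < 128 then 48 * (g / tri) / 200000
     else 48 * 128 / 200000 + 4 / 128 - 2 / (g / tri))"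
  using assms(2-)
proof (induction k arbitrary: g)
  case (Suc k)
  define x where "x = g / tri"
  have x: "0 < x" "g / 2 / tri = x / 2" using Suc.prems assms(1) by (simp_all add: x_def)
  have acc: "ex (est g) (indicat_real (- good)) 0 \<le> 24 * x / 200000"
    using est_inaccurate[OF Suc.prems(1) assms(1)] by (simp add: x_def mult.commute)
  show ?case
  proof (cases "g \<le> tri / 2")
    case True
    then have "x < 128" using assms(1) by (simp add: x_def pos_divide_less_eq)
    then show ?thesis
      using search_fail_Suc(3)[OF assms(1) True, of k] acc x unfolding x_def[symmetric] by simp
  next
    case False
    \<comment> \<open>With one level left, the depth hypothesis already gives
      \<open>g \<le> tri / 2\<close>, the case treated above.\<close>
    have "0 < k"
    proof (rule ccontr)
      assume "\<not> 0 < k"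
      then show False using Suc.prems False by simp
    qed
    moreover have "4 * (g / 2) \<le> tri * 2 ^ k" using Suc.prems by simp
    ultimately have IH: "ex (sea k (g / 2)) (indicat_real (- good)) 0 \<le>
        (if x / 2 < 128 then 48 * (x / 2) / 200000
         else 48 * 128 / 200000 + 4 / 128 - 2 / (x / 2))"
      unfolding x(2)[symmetric] using Suc.prems(1) by (intro Suc.IH) simp_all
    show ?thesis
    proof (cases "x < 128")
      case True
      then show ?thesis
        using search_fail_Suc(1)[of k g] acc IH unfolding x_def[symmetric] by simp
    next
      case False
      have "(g * tri + tri\<^sup>2) / g\<^sup>2 = 1 / x + (1 / x) * (1 / x)"
        using Suc.prems assms(1) by (simp add: x_def field_simps power2_eq_square)
      also have "\<dots> \<le> 1 / x + (1 / x) * 1"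
        using False by (intro add_left_mono mult_left_mono) auto
      finally have "ex (est g) (indicat_real {g..}) 0 \<le> 2 / x"
        using est_large[OF Suc.prems(1)] by simp
      moreover have "ex (sea k (g / 2)) (indicat_real (- good)) 0 \<le>
          48 * 128 / 200000 + 4 / 128 - 4 / x"
      \<comment> \<open>When halving crosses 128, the summand \<open>4 / 128\<close> of the bound
        compensates \<open>- 4 / x\<close>.\<close>
      proof (cases "x / 2 < 128")
        case True
        have "4 / x \<le> 4 / 128" using \<open>\<not> x < 128\<close> by (intro divide_left_mono) auto
        moreover have "48 * (x / 2) / 200000 \<le> 48 * 128 / 200000" using True by simp
        ultimately show ?thesis using IH True by simp
      qed (use IH in simp)
      moreover have "4 / x = 2 / x + 2 / x" by simp
      ultimately have "ex (sea (Suc k) g) (indicat_real (- good)) 0 \<le>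
          48 * 128 / 200000 + 4 / 128 - 2 / x"
        using search_fail_Suc(2)[of k g] by linarith
      then show ?thesis using False unfolding x_def[symmetric] by simp
    qed
  qed
qed simp

lemma search_fail_le:
  assumes "0 < tri" "0 < g" "0 < k" "4 * g \<le> tri * 2 ^ k"
  shows "ex (sea k g) (indicat_real (- good)) 0 \<le> 1 / 16"
proof -
  have "0 \<le> 2 / (g / tri)" using assms by simp
  then show ?thesis using search_fail[OF assms] by (auto split: if_splits)
qed

text \<open>With \<open>tri = 0\<close> the second moment of every estimate vanishes, so no positive
  guess is accepted and the default 0 is reached.\<close>

lemma search_no_triangles:
  assumes "tri = 0" "0 < g"
  shows "ex (sea k g) (indicat_real (- good)) 0 \<le> 0"
  using assms(2)
proof (induction k arbitrary: g)
  case 0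
  then show ?case using assms(1) by simp
next
  case (Suc k)
  have "ex (est g) (indicat_real {g..}) 0 \<le> 0"
    using est_large[OF Suc.prems] assms(1) by simp
  moreover have "ex (sea k (g / 2)) (indicat_real (- good)) 0 \<le> 0"
    using Suc.prems by (intro Suc.IH) simp
  ultimately show ?case using search_fail_Suc(2)[of k g] by linarith
qed

lemma cost_search_Suc:
  "cost (sea (Suc k) g) \<le> cost (est g) + cost (sea k (g / 2))" (is ?A)
  "0 < tri \<Longrightarrow> g \<le> tri / 2 \<Longrightarrow> cost (sea (Suc k) g) \<le>
     cost (est g) + ex (est g) (indicat_real (- good)) 0 * cost (sea k (g / 2))"
proof -
  let ?f = "cost (sea k (g / 2))"
  have f: "0 \<le> ?f" by (rule cost_nonneg)
  have eq: "cost (sea (Suc k) g) = cost (est g) + ex (est g) (\<lambda>y. if g \<le> y then 0 else ?f) 0"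
    by (simp add: cost_bind if_distrib[of "\<lambda>A. cost A"] cong: if_cong)
  have "ex (est g) (\<lambda>y. if g \<le> y then 0 else ?f) 0 \<le> ex (est g) (\<lambda>y. ?f) 0"
    using f by (intro expect_mono) auto
  then show ?A unfolding eq by (simp add: ex_const finite_tosses_est)
  assume T: "0 < tri" "g \<le> tri / 2"
  have "\<eta> * tri < 1 / 2 * tri" using \<eta> T by (intro mult_strict_right_mono)
  moreover have "(1 - \<eta>) * tri = tri - \<eta> * tri" by (simp add: algebra_simps)
  ultimately have "g < (1 - \<eta>) * tri" using T by linarith
  then have "ex (est g) (\<lambda>y. if g \<le> y then 0 else ?f) 0 \<le>
      ex (est g) (\<lambda>y. ?f * indicat_real (- good) y) 0"
    using f by (intro expect_mono) (auto simp: indicator_def)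
  then show "cost (sea (Suc k) g) \<le>
      cost (est g) + ex (est g) (indicat_real (- good)) 0 * ?f"
    unfolding eq expect_mult0 by (simp add: mult.commute)
qed

text \<open>Halving the guess doubles the cost, but below \<open>tri / 2\<close> the search
  continues only after an inaccurate estimate, with probability at most \<open>1 / 4\<close>:
  \<open>W / g + 1 / 4 * (4 * W / g) = 2 * W / g\<close>.\<close>

lemma cost_search_small:
  assumes "0 < tri"
  defines "W \<equiv> 162 * (200000 * m * real \<tau> / \<eta>\<^sup>2)"
  assumes "0 < g" "g \<le> tri / 2" "g \<le> m * real \<tau>"
  shows "cost (sea k g) \<le> 2 * W / g"
  using assms(3-)
proof (induction k arbitrary: g)
  case 0
  have "0 \<le> W" by (simp add: W_def)
  then show ?case using 0 by simp
next
  case (Suc k)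
  have IH: "cost (sea k (g / 2)) \<le> 2 * W / (g / 2)"
    using Suc.prems by (intro Suc.IH) auto
  have "ex (est g) (indicat_real (- good)) 0 \<le> 24 * g / (200000 * tri)"
    by (rule est_inaccurate[OF Suc.prems(1) assms(1)])
  also have "\<dots> \<le> 1 / 4" using Suc.prems assms(1) by (simp add: field_simps)
  finally have "ex (est g) (indicat_real (- good)) 0 * cost (sea k (g / 2)) \<le> 1 / 4 * (2 * W / (g / 2))"
    using IH cost_nonneg by (intro mult_mono) auto
  moreover have "cost (est g) \<le> W / g"
    unfolding W_def by (rule cost_est[OF Suc.prems(1,3)])
  ultimately show ?case
    using cost_search_Suc(2)[OF assms(1) Suc.prems(2), of k] by simp
qed

text \<open>The costs \<open>W / g\<close> double along the guesses; the term \<open>- W / g\<close>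
  makes the sum telescope. The last guess above \<open>tri / 2\<close> and everything after it cost
  at most \<open>5 * W / g\<close>, and \<open>6 * W / g \<le> 12 * W / tri\<close>.\<close>

lemma cost_search:
  assumes "0 < tri"
  defines "W \<equiv> 162 * (200000 * m * real \<tau> / \<eta>\<^sup>2)"
  assumes "tri / 2 < g" "g \<le> m * real \<tau>"
  shows "cost (sea k g) \<le> 12 * (W / tri) - W / g"
  using assms(3-)
proof (induction k arbitrary: g)
  case 0
  have W: "0 \<le> W" by (simp add: W_def)
  then have "W / g \<le> W / (tri / 2)" using 0 assms(1) by (intro divide_left_mono) auto
  moreover have "0 \<le> W / tri" using W assms(1) by simp
  ultimately show ?case using 0 by simp
next
  case (Suc k)
  have W: "0 \<le> W" by (simp add: W_def)
  have g: "0 < g" using Suc.prems assms(1) by simp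
  have est: "cost (est g) \<le> W / g"
    unfolding W_def by (rule cost_est[OF g Suc.prems(2)])
  show ?case
  proof (cases "tri / 2 < g / 2")
    case True
    then have "cost (sea k (g / 2)) \<le> 12 * (W / tri) - W / (g / 2)"
      using Suc.prems by (intro Suc.IH) auto
    then show ?thesis using est cost_search_Suc(1)[of k g] by simp
  next
    case False
    then have "cost (sea k (g / 2)) \<le> 2 * W / (g / 2)"
      unfolding W_def using Suc.prems g assms(1) by (intro cost_search_small) auto
    moreover have "W / g \<le> W / (tri / 2)"
      using W Suc.prems assms(1) by (intro divide_left_mono) auto
    ultimately show ?thesis using est cost_search_Suc(1)[of k g] by simp
  qed
qed

end

text \<open>Chernoff with base 16: each failing run multiplies the potential by 16, and a median outside the
  interval needs at least half of the runs to fail.\<close>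

lemma median_of_runs_fail:
  assumes "finite_tosses A" "ex A (indicat_real (- {lo..hi})) 0 \<le> 1 / 16" "0 < k + length xs"
  shows "ex (median_of_runs k A xs) (indicat_real (- {lo..hi})) 0 \<le>
    2 ^ k * 16 ^ length (filter (\<lambda>x. x \<notin> {lo..hi}) xs) / 4 ^ (k + length xs)"
  using assms(3)
proof (induction k arbitrary: xs)
  case 0
  let ?b = "length (filter (\<lambda>x. x \<notin> {lo..hi}) xs)"
  show ?case
  proof (cases "median xs \<in> {lo..hi}")
    case False
    then have "length xs \<le> 2 * ?b" using 0 by (intro median_outside) auto
    then have "(4::real) ^ length xs \<le> 4 ^ (2 * ?b)" by (intro power_increasing) auto
    then have "(4::real) ^ length xs \<le> 16 ^ ?b" by (simp add: power_mult)
    then show ?thesis by (simp add: indicator_def)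
  qed simp
next
  case (Suc k)
  let ?b = "\<lambda>xs. length (filter (\<lambda>x. x \<notin> {lo..hi}) xs)"
  define C :: real where "C = 2 ^ k * 16 ^ ?b xs / 4 ^ (Suc k + length xs)"
  have C: "0 \<le> C" by (simp add: C_def)
  have "ex (median_of_runs (Suc k) A xs) (indicat_real (- {lo..hi})) 0 =
      ex A (\<lambda>x. ex (median_of_runs k A (x # xs)) (indicat_real (- {lo..hi})) 0) 0"
    by (simp add: expect_bind)
  also have "\<dots> \<le> ex A (\<lambda>x. C * (1 + 15 * indicat_real (- {lo..hi}) x)) 0"
  proof (rule expect_mono)
    fix x
    have "ex (median_of_runs k A (x # xs)) (indicat_real (- {lo..hi})) 0 \<le>
        2 ^ k * 16 ^ ?b (x # xs) / 4 ^ (k + length (x # xs))"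
      by (rule Suc.IH) simp
    also have "\<dots> = C * (1 + 15 * indicat_real (- {lo..hi}) x)"
      by (simp add: C_def indicator_def)
    finally show "ex (median_of_runs k A (x # xs)) (indicat_real (- {lo..hi})) 0 \<le>
      C * (1 + 15 * indicat_real (- {lo..hi}) x)" .
  qed
  also have "\<dots> = C * (1 + 15 * ex A (indicat_real (- {lo..hi})) 0)"
    by (simp only: expect_mult0 expect_add0 ex_const[OF assms(1)])
  \<comment> \<open>A run multiplies the potential by at most \<open>1 + 15 / 16\<close> in
    expectation.\<close>
  also have "\<dots> \<le> C * 2"
    using assms(2) C by (intro mult_left_mono) auto
  finally show ?case by (simp add: C_def)
qed

lemma cost_median_of_runs:
  "finite_tosses A \<Longrightarrow> cost (median_of_runs k A xs) = real k * cost A"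
  by (induction k arbitrary: xs) (simp_all add: cost_bind ex_const algebra_simps)

end

section \<open>Repetition, choice of parameters and the final bound\<close>

lemma finite_tosses_triangle_counter:
  assumes "0 < \<alpha>" "0 < \<epsilon>"
  shows "finite_tosses (triangle_counter m \<alpha> \<epsilon> \<delta>)"
proof -
  have "0 < nat \<lceil>24 * real \<alpha> / \<epsilon>\<rceil>" using assms by simp
  moreover have "finite (set_pmf (coin p))" for p
    by (rule finite_subset[OF set_pmf_coin]) simp
  ultimately show ?thesis
    using assms
    by (auto simp: triangle_counter_def intro!: finite_tosses_median_of_runs finite_tosses_search)
qed

text \<open>For \<open>\<delta> \<le> 1 / 2\<close> the coin is certain and
  \<open>L \<le> 2 * log 2 (1 / \<delta>)\<close>, where \<open>ln 2 \<ge> 2 / 3\<close> yields the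
  factor 3. Otherwise \<open>L = 1\<close>: a run succeeds with probability at least
  \<open>1 / 2\<close>, so running with probability \<open>2 * (1 - \<delta>)\<close> suffices, and
  \<open>1 - \<delta> \<le> ln (1 / \<delta>)\<close> bounds the cost.\<close>

lemma repetition_bounds:
  fixes \<delta> :: real
  assumes "0 < \<delta>" "\<delta> < 1"
  defines "p \<equiv> min 1 (2 * (1 - \<delta>))" and "L \<equiv> nat \<lceil>log 2 (1 / \<delta>)\<rceil>"
  shows "0 < L" "0 \<le> p" "p \<le> 1" "p * real L \<le> 3 * ln (1 / \<delta>)"
    "1 - \<delta> \<le> p * (1 - (1 / 2) ^ L)"
proof -
  let ?l = "log 2 (1 / \<delta>)"
  have l: "0 < ?l" using assms by simp
  then show L: "0 < L" unfolding L_def by simp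
  show p: "0 \<le> p" "p \<le> 1" using assms by (auto simp: p_def)
  have "1 / \<delta> = 2 powr ?l" using assms by simp
  also have "\<dots> \<le> 2 powr real L"
    using real_nat_ceiling_ge[of ?l] by (intro powr_mono) (auto simp: L_def)
  finally have "1 / \<delta> \<le> 2 ^ L" by (simp add: powr_realpow)
  then have half: "(1 / 2) ^ L \<le> \<delta>" using assms by (simp add: power_divide field_simps)
  have ln: "1 - \<delta> \<le> ln (1 / \<delta>)"
    using ln_le_minus_one[of \<delta>] assms by (simp add: ln_div)
  show "p * real L \<le> 3 * ln (1 / \<delta>)"
  proof (cases "\<delta> \<le> 1 / 2")
    case True
    then have "2 \<le> 1 / \<delta>" using assms by (simp add: field_simps)
    then have "1 \<le> ?l" using assms by (subst one_le_log_cancel_iff) auto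
    then have "real L \<le> 2 * ?l" using real_nat_ceiling_le[OF less_imp_le[OF l]] unfolding L_def by linarith
    also have "\<dots> \<le> 3 * ln (1 / \<delta>)"
    proof -
      have "ln (1 / \<delta>) = ?l * ln 2" by (simp add: log_def)
      moreover have "?l * (2 / 3) \<le> ?l * ln 2"
        using l ln2_ge_two_thirds by (intro mult_left_mono) auto
      ultimately show ?thesis by linarith
    qed
    finally have "real L \<le> 3 * ln (1 / \<delta>)" .
    moreover have "p * real L \<le> 1 * real L" using p by (intro mult_right_mono) auto
    ultimately show ?thesis by linarith
  next
    case False
    then have "1 / \<delta> < 2" using assms by (simp add: field_simps)
    then have "?l < 1" using assms by (simp add: log_less_one_cancel_iff)
    then have "L = 1" using l unfolding L_def by linarith
    then show ?thesis using ln assms by (simp add: p_def)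
  qed
  show "1 - \<delta> \<le> p * (1 - (1 / 2) ^ L)"
  proof (cases "\<delta> \<le> 1 / 2")
    case True
    then show ?thesis using half by (simp add: p_def)
  next
    case False
    have "(1 / 2 :: real) ^ L \<le> (1 / 2) ^ 1" using L by (intro power_decreasing) auto
    then have "p * (1 / 2) \<le> p * (1 - (1 / 2) ^ L)" using p by (intro mult_left_mono) auto
    then show ?thesis using False by (simp add: p_def)
  qed
qed

context query_model
begin

lemma triangle_counter_bounds:
  assumes \<alpha>: "0 < \<alpha>" and \<epsilon>: "0 < \<epsilon>" "\<epsilon> < 1" and \<delta>: "0 < \<delta>" "\<delta> < 1"
  shows "1 - \<delta> \<le> ex (triangle_counter (card E) \<alpha> \<epsilon> \<delta>)
      (indicat_real {(1 - \<epsilon>) * tri..(1 + \<epsilon>) * tri}) 0"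
    and "0 < tri \<Longrightarrow> cost (triangle_counter (card E) \<alpha> \<epsilon> \<delta>) \<le>
      36 * 162 * 200000 * 100 * (m * real \<alpha> * ln (1 / \<delta>) / (\<epsilon> ^ 3 * tri))"
proof -
  define p L where "p = min 1 (2 * (1 - \<delta>))" and "L = nat \<lceil>log 2 (1 / \<delta>)\<rceil>"
  note rep = repetition_bounds[OF \<delta>, folded p_def L_def]
  define \<tau> where "\<tau> = nat \<lceil>24 * real \<alpha> / \<epsilon>\<rceil>"
  define \<eta> where "\<eta> = \<epsilon> / 2"
  have \<eta>: "0 < \<eta>" "\<eta> < 1 / 2" using \<epsilon> by (auto simp: \<eta>_def)
  have \<tau>: "12 * real \<alpha> / \<eta> \<le> real \<tau>"
    unfolding \<tau>_def \<eta>_def using real_nat_ceiling_ge[of "24 * real \<alpha> / \<epsilon>"] by simp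
  note ctx = \<alpha> \<eta> \<tau>
  define S where "S = search (card E) \<tau> \<alpha> \<eta> (8 * card E * \<alpha>) (2 * m * real \<alpha>)"
  define B where "B = median_of_runs L S []"
  have fS: "finite_tosses S" unfolding S_def by (rule finite_tosses_sea[OF ctx])
  then have fB: "finite_tosses B" unfolding B_def by (rule finite_tosses_median_of_runs)
  have E0: "card E \<noteq> 0" using m_pos by simp
  have "triangle_counter (card E) \<alpha> \<epsilon> \<delta> = Toss (coin p) (\<lambda>b. if b = 0 then Output 0 else B)"
    unfolding triangle_counter_def B_def S_def p_def L_def \<tau>_def \<eta>_def using E0 by simp
  then have counter: "ex (triangle_counter (card E) \<alpha> \<epsilon> \<delta>) F c = p * ex B F c + (1 - p) * F 0" for F c
    by (simp only: expect.simps sum_coin[OF rep(2,3)]) simp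
  have g: "0 < 2 * m * real \<alpha>" using m_pos \<alpha> by simp
  let ?G = "{(1 - \<eta>) * tri..(1 + \<eta>) * tri}"
  have failS: "ex S (indicat_real (- ?G)) 0 \<le> 1 / 16"
  proof (cases "tri = 0")
    case True
    then show ?thesis
      unfolding S_def by (intro order_trans[OF search_no_triangles[OF ctx True g]]) simp
  next
    case False
    then have T: "1 \<le> tri" by simp
    show ?thesis unfolding S_def
    proof (rule search_fail_le[OF ctx _ g])
      \<comment> \<open>The depth \<open>8 * m * \<alpha>\<close> is four times the starting guess;
        being generous is harmless, since \<open>cost_search\<close> does not depend on the
        depth.\<close>
      have "real (8 * card E * \<alpha>) < 2 ^ (8 * card E * \<alpha>)"
        using less_exp[of "8 * card E * \<alpha>"] by (metis of_nat_less_iff of_nat_numeral of_nat_power)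
      also have "\<dots> \<le> tri * 2 ^ (8 * card E * \<alpha>)" using T by simp
      finally show "4 * (2 * m * real \<alpha>) \<le> tri * 2 ^ (8 * card E * \<alpha>)" by simp
    qed (use T E0 \<alpha> in simp_all)
  qed
  have "ex B (indicat_real (- ?G)) 0 \<le> 2 ^ L / 4 ^ L"
    using median_of_runs_fail[OF fS failS, of L "[]"] rep(1) by (simp add: B_def)
  also have "\<dots> = (1 / 2) ^ L" by (simp flip: power_divide)
  finally have failB: "ex B (indicat_real (- ?G)) 0 \<le> (1 / 2) ^ L" .
  have "(\<lambda>x. indicat_real ?G x + indicat_real (- ?G) x) = (\<lambda>_. 1)"
    by (auto simp: indicator_def fun_eq_iff)
  then have "ex B (\<lambda>x. indicat_real ?G x + indicat_real (- ?G) x) 0 = 1"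
    using ex_const[OF fB, of 1] by simp
  then have goodB: "1 - (1 / 2) ^ L \<le> ex B (indicat_real ?G) 0"
    using failB by (simp only: expect_add0)
  have sub: "?G \<subseteq> {(1 - \<epsilon>) * tri..(1 + \<epsilon>) * tri}"
  proof -
    have "(1 - \<epsilon>) * tri \<le> (1 - \<eta>) * tri" "(1 + \<eta>) * tri \<le> (1 + \<epsilon>) * tri"
      using \<epsilon> by (auto simp: \<eta>_def intro!: mult_right_mono)
    then show ?thesis by auto
  qed
  let ?I = "indicat_real {(1 - \<epsilon>) * tri..(1 + \<epsilon>) * tri}"
  have "ex B (indicat_real ?G) 0 \<le> ex B ?I 0"
    using sub by (intro expect_mono) (auto simp: indicator_def)
  then have "p * (1 - (1 / 2) ^ L) \<le> p * ex B ?I 0"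
    using goodB rep(2) by (intro mult_left_mono) auto
  moreover have "0 \<le> (1 - p) * ?I 0" using rep(3) by simp
  ultimately show "1 - \<delta> \<le> ex (triangle_counter (card E) \<alpha> \<epsilon> \<delta>) ?I 0"
    unfolding counter using rep(5) by linarith
  assume T: "0 < tri"
  define W where "W = 162 * (200000 * m * real \<tau> / \<eta>\<^sup>2)"
  have W: "0 \<le> W" by (simp add: W_def)
  have "2 * m * real \<alpha> = m * (2 * real \<alpha>)" by simp
  also have "\<dots> \<le> m * real \<tau>" using tau_ge[OF ctx] by (intro mult_left_mono) auto
  finally have g_le: "2 * m * real \<alpha> \<le> m * real \<tau>" .
  have "tri / 2 < 2 * m * real \<alpha>" using triangles_le T by (simp add: mult_ac)
  then have "cost S \<le> 12 * (W / tri) - W / (2 * m * real \<alpha>)"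
    unfolding S_def W_def by (rule cost_search[OF ctx T _ g_le])
  also have "\<dots> \<le> 12 * (W / tri)" using W g by simp
  finally have costS: "cost S \<le> 12 * (W / tri)" .
  have "cost (triangle_counter (card E) \<alpha> \<epsilon> \<delta>) = (p * real L) * cost S"
    by (simp add: counter B_def cost_median_of_runs[OF fS])
  also have "\<dots> \<le> (3 * ln (1 / \<delta>)) * (12 * (W / tri))"
    by (rule mult_mono[OF rep(4) costS]) (use \<delta> cost_nonneg in auto)
  \<comment> \<open>\<open>\<tau> \<le> 25 * \<alpha> / \<epsilon>\<close>, as rounding adds at most
    1, and \<open>1 / \<eta>\<^sup>2 = 4 / \<epsilon>\<^sup>2\<close>; hence the factor 100 and the
    cube of \<open>\<epsilon>\<close>.\<close>
  also have "W \<le> 162 * 200000 * 100 * (m * real \<alpha> / \<epsilon> ^ 3)"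
  proof -
    have "1 \<le> real \<alpha> / \<epsilon>" using \<alpha> \<epsilon> by (simp add: field_simps)
    moreover have "real \<tau> \<le> 24 * real \<alpha> / \<epsilon> + 1"
      unfolding \<tau>_def using \<epsilon> by (intro real_nat_ceiling_le) simp
    ultimately have "real \<tau> \<le> 25 * (real \<alpha> / \<epsilon>)" by simp
    then have "(m / \<eta>\<^sup>2) * real \<tau> \<le> (m / \<eta>\<^sup>2) * (25 * (real \<alpha> / \<epsilon>))"
      by (intro mult_left_mono) auto
    also have "\<dots> = 100 * (m * real \<alpha> / \<epsilon> ^ 3)"
      by (simp add: \<eta>_def power2_eq_square power3_eq_cube)
    finally show ?thesis by (simp add: W_def)
  qed
  then have "(3 * ln (1 / \<delta>)) * (12 * (W / tri)) \<le>
      (3 * ln (1 / \<delta>)) * (12 * (162 * 200000 * 100 * (m * real \<alpha> / \<epsilon> ^ 3) / tri))"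
    using T \<delta> by (intro mult_left_mono divide_right_mono) auto
  also have "\<dots> = 36 * 162 * 200000 * 100 * (m * real \<alpha> * ln (1 / \<delta>) / (\<epsilon> ^ 3 * tri))"
    by simp
  finally show "cost (triangle_counter (card E) \<alpha> \<epsilon> \<delta>) \<le>
      36 * 162 * 200000 * 100 * (m * real \<alpha> * ln (1 / \<delta>) / (\<epsilon> ^ 3 * tri))" .
qed

end

theorem mainTheorem1:
  "\<exists>(C::real) (k::nat). \<forall>\<epsilon> \<delta> :: real. 0 < \<epsilon> \<and> \<epsilon> < 1 \<and> 0 < \<delta> \<and> \<delta> < 1 \<longrightarrow>
     (\<exists>A :: nat \<Rightarrow> nat \<Rightarrow> nat \<Rightarrow> real \<Rightarrow> real \<Rightarrow> algorithm.
        \<forall>V E nb. simple_graph V E \<and> neighbour_order V E nb \<longrightarrow>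
          (let n = card V; m = card E; \<alpha> = arboricity E; T = card (triangles V E);
               R = run E nb (A n m \<alpha> \<epsilon> \<delta>)
           in (T > 0 \<longrightarrow> expected_queries R \<le>
                 ennreal (C * (real m * real \<alpha> * ln (1 / \<delta>) / (\<epsilon> ^ 3 * real T)) * ln (real n) ^ k)) \<and>
              output_prob R {(1 - \<epsilon>) * real T .. (1 + \<epsilon>) * real T} \<ge> 1 - \<delta>))"
\<comment> \<open>36 is 3 for the repetitions times 12 for the search. The exponent 0 says that no
  logarithmic factor in \<open>n\<close> is lost.\<close>
proof (intro exI[of _ "36 * 162 * 200000 * 100 :: real"] exI[of _ "0::nat"] allI impI
    exI[of _ "\<lambda>n m \<alpha> \<epsilon> \<delta>. triangle_counter m \<alpha> \<epsilon> \<delta>"])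
  fix \<epsilon> \<delta> :: real and V E nb
  assume "0 < \<epsilon> \<and> \<epsilon> < 1 \<and> 0 < \<delta> \<and> \<delta> < 1" and g: "simple_graph V E \<and> neighbour_order V E nb"
  then have par: "0 < \<epsilon>" "\<epsilon> < 1" "0 < \<delta>" "\<delta> < 1" by auto
  have edge: "e \<subseteq> V" "card e = 2" if "e \<in> E" for e
    using g that by (auto simp: simple_graph_def)
  have finE: "finite E"
    using g edge by (intro finite_subset[of E "Pow V"]) (auto simp: simple_graph_def)
  have "(0 < card (triangles V E) \<longrightarrow> expected_queries (run E nb (triangle_counter (card E) (arboricity E) \<epsilon> \<delta>)) \<le>
      ennreal (36 * 162 * 200000 * 100 * (real (card E) * real (arboricity E) * ln (1 / \<delta>) /
        (\<epsilon> ^ 3 * real (card (triangles V E)))) * ln (real (card V)) ^ 0)) \<and>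
    1 - \<delta> \<le> output_prob (run E nb (triangle_counter (card E) (arboricity E) \<epsilon> \<delta>))
      {(1 - \<epsilon>) * real (card (triangles V E))..(1 + \<epsilon>) * real (card (triangles V E))}"
  proof (cases "E = {}")
    \<comment> \<open>\<open>query_model\<close> assumes an edge, so the edgeless graph is settled
      separately: it has no triangle and the counter outputs 0.\<close>
    case True
    have "triangles V E = {}"
    proof (rule ccontr)
      assume "triangles V E \<noteq> {}"
      then obtain S where S: "S \<in> triangles V E" by auto
      then obtain x y z where "S = {x, y, z}" "x \<noteq> y" by (auto simp: triangles_def card_3_iff)
      then show False using S True by (auto simp: triangles_def)
    qed
    then show ?thesis using True par by (simp add: triangle_counter_def output_prob_def)
  next
    case False
    obtain out :: "nat \<Rightarrow> nat set" where out: "\<And>a. finite (out a)" "\<And>a. card (out a) \<le> arboricity E"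
      "\<And>a b. {a, b} \<in> E \<Longrightarrow> b \<in> out a \<or> a \<in> out b"
      using arboricity_orientation[OF finE edge(2)] by blast
    interpret query_model E out "arboricity E" nb
    proof
      show "bij_betw (nb v) {..<degree E v} (neighbours E v)" if "v \<in> \<Union>E" for v
        using g edge that by (auto simp: neighbour_order_def)
    qed (use finE edge out False in auto)
    have \<alpha>: "0 < arboricity E"
    proof (rule ccontr)
      assume "\<not> 0 < arboricity E"
      then have empty: "out a = {}" for a using out(1,2)[of a] by auto
      obtain e where "e \<in> E" using False by auto
      then show False using out(3)[of "Min e" "Max e"] min_max_edge empty by auto
    qed
    have T: "card (sorted_triads E) = card (triangles V E)"
      using edge(1) by (rule card_sorted_triads)
    note fin = finite_tosses_triangle_counter[OF \<alpha> par(1), of "card E" \<delta>] finE False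
    show ?thesis
      using triangle_counter_bounds[OF \<alpha> par]
      unfolding expected_queries_run[OF fin] output_prob_run[OF fin] T power_0 mult_1_right
      by (intro conjI impI ennreal_leI) simp_all
  qed
  then show "let n = card V; m = card E; \<alpha> = arboricity E; T = card (triangles V E);
      R = run E nb (triangle_counter m \<alpha> \<epsilon> \<delta>)
    in (T > 0 \<longrightarrow> expected_queries R \<le>
          ennreal (36 * 162 * 200000 * 100 * (real m * real \<alpha> * ln (1 / \<delta>) / (\<epsilon> ^ 3 * real T)) * ln (real n) ^ 0)) \<and>
       output_prob R {(1 - \<epsilon>) * real T .. (1 + \<epsilon>) * real T} \<ge> 1 - \<delta>"
    unfolding Let_def .
qed

end
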